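(* Let $f:\mathbb{Z}\to[0,\infty)$ be a function such that $f(-n)+f(n)=O(n\log n)$ as $n\to\infty$. Then two independent simple random walks $X=(X_n)_{n\ge0}$ and $X'=(X'_n)_{n\ge0}$ on $\mathrm{Comb}(\mathbb{Z},f)$, started from the same vertex, collide infinitely many times with probability one, i.e. $|\{n: X_n=X'_n\}|=\infty$ almost surely.
   Context: For $f:\mathbb{Z}\to[0,\infty)$, the wedge comb $\mathrm{Comb}(\mathbb{Z},f)$ is the graph with vertex set $\mathbb{V}=\{(x,y): x,y\in\mathbb{Z},\ -f(x)\le y\le f(x)\}$ and edge set $\{[(x,n),(x,m)]: |m-n|=1\}\cup\{[(x,0),(y,0)]: |x-y|=1\}$ (edges between vertices of $\mathbb{V}$). The simple random walk on a graph is the discrete-time Markov chain that at each step jumps from the current vertex to a uniformly chosen neighbour. *)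

theory Defs
  imports "HOL-Probability.Probability" "HOL-Library.Landau_Symbols"
begin

text \<open>An undirected graph is given by its vertex set \<open>V\<close> and a set \<open>E\<close> of edges, an edge being
  the unordered pair of its end points.\<close>

definition neighbours :: "'a set \<Rightarrow> 'a set set \<Rightarrow> 'a \<Rightarrow> 'a set" where
  "neighbours V E u = {w \<in> V. {u, w} \<in> E}"

text \<open>\<open>X\<close> is a realisation, on the probability space \<open>M\<close>, of the simple random walk on \<open>(V, E)\<close>
  started from \<open>v\<close>. The last clause is the Markov property together with the transition law; it
  constrains only histories of positive probability. It relies on \<open>pmf_of_set\<close>, which is
  unspecified unless the set of neighbours is finite and nonempty.\<close>

definition simple_random_walk ::
  "'w measure \<Rightarrow> 'a set \<Rightarrow> 'a set set \<Rightarrow> 'a \<Rightarrow> (nat \<Rightarrow> 'w \<Rightarrow> 'a) \<Rightarrow> bool" where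
  "simple_random_walk M V E v X \<longleftrightarrow>
     v \<in> V \<and>
     (\<forall>n. X n \<in> measurable M (count_space UNIV)) \<and>
     (AE \<omega> in M. X 0 \<omega> = v) \<and>
     (\<forall>n x w. \<P>(\<omega> in M. \<forall>i\<le>n. X i \<omega> = x i) > 0 \<longrightarrow>
        \<P>(\<omega> in M. X (Suc n) \<omega> = w \<bar> \<forall>i\<le>n. X i \<omega> = x i) =
        pmf (pmf_of_set (neighbours V E (x n))) w)"

definition comb_verts :: "(int \<Rightarrow> real) \<Rightarrow> (int \<times> int) set" where
  "comb_verts f = {(x, y). - f x \<le> of_int y \<and> of_int y \<le> f x}"

definition comb_edges :: "(int \<Rightarrow> real) \<Rightarrow> (int \<times> int) set set" where
  "comb_edges f =
     {{(x, n), (x, m)} | x n m.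
        (x, n) \<in> comb_verts f \<and> (x, m) \<in> comb_verts f \<and> \<bar>m - n\<bar> = 1} \<union>
     {{(x, 0), (y, 0)} | x y.
        (x, 0) \<in> comb_verts f \<and> (y, 0) \<in> comb_verts f \<and> \<bar>x - y\<bar> = 1}"

text \<open>On the comb the caveat about \<open>pmf_of_set\<close> is void.\<close>

lemma finite_neighbours_comb: "finite (neighbours (comb_verts f) (comb_edges f) u)"
proof (rule finite_subset)
  show "neighbours (comb_verts f) (comb_edges f) u
      \<subseteq> {fst u - 1..fst u + 1} \<times> {snd u - 1..snd u + 1}"
    by (auto simp: neighbours_def comb_edges_def doubleton_eq_iff)
qed simp

lemma neighbours_comb_nonempty:
  assumes "\<And>x. 0 \<le> f x" and "u \<in> comb_verts f"
  shows "neighbours (comb_verts f) (comb_edges f) u \<noteq> {}"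
proof -
  obtain x y where u: "u = (x, y)" by (cases u)
  show ?thesis
  proof (cases "y = 0")
    case True
    have v: "(x, 0) \<in> comb_verts f" "(x + 1, 0) \<in> comb_verts f"
      using assms(1)[of x] assms(1)[of "x + 1"] by (auto simp: comb_verts_def)
    moreover have "\<bar>x - (x + 1)\<bar> = 1" by simp
    ultimately have "{u, (x + 1, 0)} \<in> comb_edges f"
      unfolding comb_edges_def u True by blast
    then have "(x + 1, 0) \<in> neighbours (comb_verts f) (comb_edges f) u"
      using v by (simp add: neighbours_def)
    then show ?thesis by blast
  next
    case False
    define z where "z = y - sgn y"
    have yz: "\<bar>z - y\<bar> = 1"
      using False by (auto simp: z_def sgn_if)
    have z: "(x, z) \<in> comb_verts f"
      using assms False by (auto simp: u z_def comb_verts_def sgn_if)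
    have "{u, (x, z)} \<in> comb_edges f"
      using yz z assms(2) unfolding comb_edges_def u by blast
    then have "(x, z) \<in> neighbours (comb_verts f) (comb_edges f) u"
      using z by (simp add: neighbours_def)
    then show ?thesis by blast
  qed
qed

end

theory Submission
  imports Defs "HOL-Real_Asymp.Real_Asymp"
begin

text \<open>
  Let \<open>s x y\<close> be the probability that independent walks started from \<open>x\<close> and \<open>y\<close> never meet. Every
  step changes the parity of \<open>fst u + snd u\<close>, so two walks from the same vertex always sit on
  vertices of equal parity, and by the Markov property it suffices that \<open>s x y = 0\<close> for all \<open>x\<close> and
  \<open>y\<close> of equal parity (\<open>avoidance_zero\<close>, \<open>AE_infinite_collisions\<close>).

  Kill both walks when they leave the box of columns \<open>\<bar>x\<bar> \<le> N\<close>, and let \<open>G x y\<close> be the expected number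
  of meetings at height below \<open>N\<close> before one of them is killed, a meeting at \<open>u\<close> having weight
  \<open>1 / deg u\<close> (the function \<open>overlap low\<close>, with a finite time horizon). Splitting at the first such
  meeting, at a vertex \<open>a\<close> say, from which on a weighted number \<open>G a a\<close> of meetings is to be expected,
  one sees that the walks meet before they are killed with probability at least \<open>G x y\<close> divided by
  the maximum of \<open>G a a\<close> over these \<open>a\<close>.

  The maximum is of order \<open>N\<close>: by reversibility \<open>G a a\<close> is at most the Green function of the killed
  walk at \<open>a\<close>, hence at most a constant times the effective resistance between \<open>a\<close> and the
  complement of the box (\<open>overlap_low_le\<close>).

  For the numerator, \<open>G x y\<close> is an inner product of the space-time heat kernels of \<open>x\<close> and \<open>y\<close>. The
  squared distance of the kernels of two vertices of equal parity is at most twice the resistance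
  between them (\<open>sum_norm_le_resistance\<close>), so \<open>G x y\<close> is comparable with \<open>G c c\<close> for a vertex \<open>c\<close> near the
  middle of the spine as soon as \<open>x\<close> and \<open>y\<close> lie in a much smaller box. Without the restriction on the
  height, \<open>G c c\<close> would be the Green function at \<open>c\<close>, which is at least \<open>N / 4\<close> (\<open>norm_sum_ge\<close>). The
  restriction costs a factor of order \<open>K\<close>, if no tooth of the box is longer than \<open>K * N\<close>: the
  square of the heat kernel, summed over time, is subharmonic, hence decreases along a tooth
  towards its tip, so the lowest \<open>N\<close> vertices of a tooth carry a share of at least \<open>1 / K\<close>
  (\<open>overlap_low_ge\<close>).

  For \<open>f n = O (n log n)\<close> one may take \<open>K\<close> of order \<open>log N\<close>. The walks therefore meet with probability
  at least \<open>c / log N\<close> before one of them leaves the box of radius \<open>N\<close>, provided that they start in a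
  box whose radius is smaller than \<open>N\<close> by a factor of order \<open>(log N)\<^sup>2\<close>. Hence a bound for \<open>s\<close> on the
  large box improves by the factor \<open>1 - c / log N\<close> on the small one (\<open>avoidance_contraction\<close>). For the
  radii \<open>(fact j) ^ 4\<close> these factors are \<open>1 - c / (j log j)\<close>, and their product vanishes because the
  sum of the \<open>1 / (j log j)\<close> diverges.
\<close>

section \<open>The killed walk as a self-adjoint operator\<close>

lemma sum_double: "(\<Sum>n<2 * T. a n) = (\<Sum>n<T. a (2 * n) + a (2 * n + 1 :: nat))"
  for a :: "nat \<Rightarrow> real"
  by (induction T) simp_all

text \<open>The walk steps to a uniformly chosen neighbour and is killed when it leaves the finite set \<open>B\<close>.
  The graph is bipartite, with colour classes given by \<open>par\<close>.\<close>
locale killed_walk =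
  fixes nb :: "'a \<Rightarrow> 'a set" and B :: "'a set" and par :: "'a \<Rightarrow> bool"
  assumes finite_B: "finite B"
    and finite_nb: "finite (nb u)"
    and nb_sym: "w \<in> nb u \<Longrightarrow> u \<in> nb w"
    and nb_nonempty: "u \<in> B \<Longrightarrow> nb u \<noteq> {}"
    and par_nb: "w \<in> nb u \<Longrightarrow> par w \<noteq> par u"
begin

definition deg :: "'a \<Rightarrow> real" where "deg u = real (card (nb u))"

text \<open>Functions on \<open>B\<close> are represented by functions on the whole type that are zero off \<open>B\<close>; the zero
  boundary values encode the killing.\<close>
definition vanishing :: "('a \<Rightarrow> real) \<Rightarrow> bool" where
  "vanishing \<phi> \<longleftrightarrow> (\<forall>u. u \<notin> B \<longrightarrow> \<phi> u = 0)"

definition step :: "('a \<Rightarrow> real) \<Rightarrow> 'a \<Rightarrow> real" where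
  "step \<phi> u = (if u \<in> B then (\<Sum>w\<in>nb u. \<phi> w) / deg u else 0)"

text \<open>The inner product of \<open>\<ell>\<^sup>2\<close> on \<open>B\<close> with the reversible measure of the walk; \<open>step\<close> is self-adjoint
  for it.\<close>
definition pairing :: "('a \<Rightarrow> real) \<Rightarrow> ('a \<Rightarrow> real) \<Rightarrow> real" where
  "pairing \<phi> \<psi> = (\<Sum>u\<in>B. deg u * (\<phi> u * \<psi> u))"

text \<open>The density of the point mass at \<open>x\<close> with respect to the reversible measure, so that pairing with
  it evaluates a function at \<open>x\<close>. For \<open>x \<notin> B\<close> it is zero: a walk that starts outside is dead. This
  convention lets the complement of \<open>B\<close> be treated as one grounded vertex below.\<close>
definition point :: "'a \<Rightarrow> 'a \<Rightarrow> real" where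
  "point x u = (if u = x \<and> x \<in> B then 1 / deg x else 0)"

text \<open>The heat kernel: \<open>heat n x u * deg u\<close> is the probability that the killed walk from \<open>x\<close> is at \<open>u\<close>
  after \<open>n\<close> steps.\<close>
definition heat :: "nat \<Rightarrow> 'a \<Rightarrow> 'a \<Rightarrow> real" where
  "heat n x = (step ^^ n) (point x)"

lemma deg_pos: "u \<in> B \<Longrightarrow> deg u > 0"
  using nb_nonempty finite_nb by (simp add: deg_def card_gt_0_iff)

lemma deg_nonneg: "deg u \<ge> 0"
  by (simp add: deg_def)

lemma vanishing_step [simp]: "vanishing (step \<phi>)"
  by (simp add: vanishing_def step_def)

lemma vanishing_point [simp]: "vanishing (point x)"
  by (simp add: vanishing_def point_def)

lemma vanishing_iterate: "vanishing \<phi> \<Longrightarrow> vanishing ((step ^^ n) \<phi>)"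
  by (cases n) auto

lemma vanishing_diff: "vanishing \<phi> \<Longrightarrow> vanishing \<psi> \<Longrightarrow> vanishing (\<lambda>u. \<phi> u - \<psi> u)"
  by (simp add: vanishing_def)

lemma vanishing_sum: "(\<And>i. i \<in> I \<Longrightarrow> vanishing (\<phi> i)) \<Longrightarrow> vanishing (\<lambda>u. \<Sum>i\<in>I. \<phi> i u)"
  by (simp add: vanishing_def)

lemma step_diff: "step (\<lambda>u. \<phi> u - \<psi> u) = (\<lambda>u. step \<phi> u - step \<psi> u)"
  by (auto simp: step_def sum_subtractf diff_divide_distrib)

lemma step_cmult: "step (\<lambda>u. c * \<phi> u) = (\<lambda>u. c * step \<phi> u)"
  by (auto simp: step_def sum_distrib_left)

lemma step_sum: "step (\<lambda>u. \<Sum>i\<in>I. \<phi> i u) = (\<lambda>u. \<Sum>i\<in>I. step (\<phi> i) u)"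
proof
  fix u
  have "(\<Sum>w\<in>nb u. \<Sum>i\<in>I. \<phi> i w) = (\<Sum>i\<in>I. \<Sum>w\<in>nb u. \<phi> i w)"
    by (rule sum.swap)
  then show "step (\<lambda>u. \<Sum>i\<in>I. \<phi> i u) u = (\<Sum>i\<in>I. step (\<phi> i) u)"
    by (simp add: step_def sum_divide_distrib)
qed

lemma iterate_diff: "(step ^^ n) (\<lambda>u. \<phi> u - \<psi> u) = (\<lambda>u. (step ^^ n) \<phi> u - (step ^^ n) \<psi> u)"
  by (induction n) (simp_all add: step_diff)

lemma iterate_cmult_sum:
  "(step ^^ n) (\<lambda>u. c * (\<Sum>i\<in>I. \<phi> i u)) = (\<lambda>u. c * (\<Sum>i\<in>I. (step ^^ n) (\<phi> i) u))"
  by (induction n) (simp_all add: step_cmult step_sum)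

lemma pairing_commute: "pairing \<phi> \<psi> = pairing \<psi> \<phi>"
  by (simp add: pairing_def mult.commute)

lemma pairing_sum_left: "pairing (\<lambda>u. \<Sum>i\<in>I. \<phi> i u) \<psi> = (\<Sum>i\<in>I. pairing (\<phi> i) \<psi>)"
  unfolding pairing_def by (subst sum.swap) (simp add: sum_distrib_left sum_distrib_right)

lemma pairing_sum_right: "pairing \<psi> (\<lambda>u. \<Sum>i\<in>I. \<phi> i u) = (\<Sum>i\<in>I. pairing \<psi> (\<phi> i))"
  by (subst (1 2) pairing_commute) (rule pairing_sum_left)

lemma pairing_diff_left: "pairing (\<lambda>u. \<phi> u - \<theta> u) \<psi> = pairing \<phi> \<psi> - pairing \<theta> \<psi>"
  by (simp add: pairing_def sum_subtractf algebra_simps)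

lemma pairing_diff_right: "pairing \<psi> (\<lambda>u. \<phi> u - \<theta> u) = pairing \<psi> \<phi> - pairing \<psi> \<theta>"
  by (simp add: pairing_def sum_subtractf algebra_simps)

lemma pairing_self_nonneg: "pairing \<phi> \<phi> \<ge> 0"
  unfolding pairing_def by (rule sum_nonneg, rule mult_nonneg_nonneg[OF deg_nonneg]) simp

lemma pairing_point:
  assumes "vanishing \<psi>"
  shows "pairing (point x) \<psi> = \<psi> x"
proof (cases "x \<in> B")
  case True
  have "pairing (point x) \<psi> = (\<Sum>u\<in>B. if u = x then \<psi> x else 0)"
    unfolding pairing_def by (rule sum.cong) (use deg_pos in \<open>auto simp: point_def\<close>, fastforce)
  with True show ?thesis by (simp add: finite_B)
next
  case False
  with assms show ?thesis by (simp add: pairing_def point_def vanishing_def)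
qed

lemma pairing_step:
  assumes "vanishing \<phi>"
  shows "pairing (step \<phi>) \<psi> = (\<Sum>u\<in>B. \<Sum>w\<in>B. if w \<in> nb u then \<phi> w * \<psi> u else 0)"
  unfolding pairing_def
proof (rule sum.cong [OF refl])
  fix u assume u: "u \<in> B"
  have "(\<Sum>w\<in>B. if w \<in> nb u then \<phi> w * \<psi> u else 0) = (\<Sum>w\<in>B \<inter> nb u. \<phi> w * \<psi> u)"
    by (simp add: sum.If_cases finite_B Collect_conj_eq)
  also have "\<dots> = (\<Sum>w\<in>nb u. \<phi> w * \<psi> u)"
    by (rule sum.mono_neutral_left) (use assms in \<open>auto simp: finite_nb vanishing_def\<close>)
  finally show "deg u * (step \<phi> u * \<psi> u) = (\<Sum>w\<in>B. if w \<in> nb u then \<phi> w * \<psi> u else 0)"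
    using u deg_pos[OF u] by (simp add: step_def sum_distrib_right)
qed

lemma step_self_adjoint:
  assumes "vanishing \<phi>" "vanishing \<psi>"
  shows "pairing (step \<phi>) \<psi> = pairing \<phi> (step \<psi>)"
proof -
  have "pairing (step \<phi>) \<psi> = (\<Sum>w\<in>B. \<Sum>u\<in>B. if w \<in> nb u then \<phi> w * \<psi> u else 0)"
    unfolding pairing_step[OF assms(1)] by (rule sum.swap)
  also have "\<dots> = pairing (step \<psi>) \<phi>"
    unfolding pairing_step[OF assms(2)]
    by (intro sum.cong refl) (use nb_sym in \<open>auto simp: mult.commute\<close>)
  finally show ?thesis by (simp add: pairing_commute)
qed

lemma iterate_self_adjoint:
  assumes "vanishing \<phi>" "vanishing \<psi>"
  shows "pairing ((step ^^ n) \<phi>) \<psi> = pairing \<phi> ((step ^^ n) \<psi>)"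
  using assms(2)
proof (induction n arbitrary: \<psi>)
  case (Suc n)
  have "pairing ((step ^^ Suc n) \<phi>) \<psi> = pairing ((step ^^ n) \<phi>) (step \<psi>)"
    using step_self_adjoint[OF vanishing_iterate[OF assms(1)] Suc.prems, of n] by simp
  also have "\<dots> = pairing \<phi> ((step ^^ n) (step \<psi>))"
    by (rule Suc.IH) simp
  finally show ?case by (simp add: funpow_swap1)
qed simp

lemma pairing_iterate_even:
  assumes "vanishing \<phi>"
  shows "pairing \<phi> ((step ^^ (2 * n)) \<phi>) = pairing ((step ^^ n) \<phi>) ((step ^^ n) \<phi>)"
proof -
  have "pairing ((step ^^ n) \<phi>) ((step ^^ n) \<phi>) = pairing \<phi> ((step ^^ n) ((step ^^ n) \<phi>))"
    by (rule iterate_self_adjoint) (simp_all add: assms vanishing_iterate)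
  then show ?thesis by (simp add: mult_2 funpow_add)
qed

text \<open>A function carried by one colour class moves to the other class with each step. Hence odd powers
  of \<open>step\<close> are invisible to it, and sums over all powers equal sums over the even ones, which are
  squared norms.\<close>
lemma iterate_parity:
  assumes "\<And>u. \<phi> u \<noteq> 0 \<Longrightarrow> par u = c" and "(step ^^ n) \<phi> u \<noteq> 0"
  shows "par u = (c = even n)"
  using assms(2)
proof (induction n arbitrary: u)
  case (Suc n)
  from Suc.prems have "(\<Sum>w\<in>nb u. (step ^^ n) \<phi> w) \<noteq> 0"
    using step_def[of "(step ^^ n) \<phi>" u] by (auto split: if_splits)
  then obtain w where "w \<in> nb u" "(step ^^ n) \<phi> w \<noteq> 0"
    by (rule sum.not_neutral_contains_not_neutral)
  with Suc.IH[of w] par_nb[of w u] show ?case by auto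
qed (use assms(1) in auto)

lemma pairing_iterate_odd:
  assumes "\<And>u. \<phi> u \<noteq> 0 \<Longrightarrow> par u = c" and "odd n"
  shows "pairing \<phi> ((step ^^ n) \<phi>) = 0"
  unfolding pairing_def
proof (rule sum.neutral, rule ballI)
  fix u
  show "deg u * (\<phi> u * (step ^^ n) \<phi> u) = 0"
    using assms(1)[of u] iterate_parity[of \<phi> c n u] assms by auto
qed

text \<open>The truncated Neumann series for the inverse of \<open>1 - step\<close>.\<close>
definition potential :: "nat \<Rightarrow> ('a \<Rightarrow> real) \<Rightarrow> 'a \<Rightarrow> real" where
  "potential T \<phi> u = (\<Sum>n<2 * T. (step ^^ n) \<phi> u)"

lemma vanishing_potential: "vanishing \<phi> \<Longrightarrow> vanishing (potential T \<phi>)"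
  unfolding potential_def by (intro vanishing_sum vanishing_iterate)

lemma potential_step: "potential T \<phi> u - step (potential T \<phi>) u = \<phi> u - (step ^^ (2 * T)) \<phi> u"
proof -
  have "step (potential T \<phi>) u = (\<Sum>n<2 * T. (step ^^ Suc n) \<phi> u)"
    unfolding potential_def[abs_def] step_sum by simp
  then show ?thesis
    unfolding potential_def
    using sum_lessThan_telescope'[of "\<lambda>n. (step ^^ n) \<phi> u" "2 * T"]
    by (simp add: sum_subtractf)
qed

lemma pairing_potential:
  assumes "vanishing \<phi>" "\<And>u. \<phi> u \<noteq> 0 \<Longrightarrow> par u = c"
  shows "pairing \<phi> (potential T \<phi>) = (\<Sum>n<T. pairing ((step ^^ n) \<phi>) ((step ^^ n) \<phi>))"
proof -
  have "pairing \<phi> (potential T \<phi>) = (\<Sum>n<2 * T. pairing \<phi> ((step ^^ n) \<phi>))"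
    unfolding potential_def[abs_def] by (rule pairing_sum_right)
  also have "\<dots> = (\<Sum>n<T. pairing \<phi> ((step ^^ (2 * n)) \<phi>) + pairing \<phi> ((step ^^ (2 * n + 1)) \<phi>))"
    by (rule sum_double)
  also have "\<dots> = (\<Sum>n<T. pairing ((step ^^ n) \<phi>) ((step ^^ n) \<phi>))"
  proof (rule sum.cong [OF refl])
    fix n
    have "pairing \<phi> ((step ^^ (2 * n + 1)) \<phi>) = 0"
      by (rule pairing_iterate_odd[of \<phi> c]) (simp_all add: assms(2))
    then show "pairing \<phi> ((step ^^ (2 * n)) \<phi>) + pairing \<phi> ((step ^^ (2 * n + 1)) \<phi>)
        = pairing ((step ^^ n) \<phi>) ((step ^^ n) \<phi>)"
      using pairing_iterate_even[OF assms(1), of n] by linarith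
  qed
  finally show ?thesis .
qed

text \<open>The Dirichlet form, up to a factor of at most two: edges inside \<open>B\<close> are counted from both ends, those
  leaving \<open>B\<close> once.\<close>
definition energy :: "('a \<Rightarrow> real) \<Rightarrow> real" where
  "energy \<psi> = (\<Sum>u\<in>B. \<Sum>w\<in>nb u. (\<psi> u - \<psi> w)\<^sup>2)"

lemma pairing_laplacian: "pairing \<psi> (\<lambda>u. \<theta> u - step \<theta> u) = (\<Sum>u\<in>B. \<Sum>w\<in>nb u. \<psi> u * (\<theta> u - \<theta> w))"
  unfolding pairing_def
proof (rule sum.cong [OF refl])
  fix u assume u: "u \<in> B"
  have "(\<Sum>w\<in>nb u. \<psi> u * (\<theta> u - \<theta> w)) = \<psi> u * (deg u * \<theta> u - (\<Sum>w\<in>nb u. \<theta> w))"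
    by (simp add: sum_distrib_left[symmetric] sum_subtractf deg_def)
  moreover have "deg u * step \<theta> u = (\<Sum>w\<in>nb u. \<theta> w)"
    using u deg_pos[OF u] by (simp add: step_def)
  ultimately
  show "deg u * (\<psi> u * (\<theta> u - step \<theta> u)) = (\<Sum>w\<in>nb u. \<psi> u * (\<theta> u - \<theta> w))"
    by (simp add: algebra_simps)
qed

lemma energy_le:
  assumes "vanishing \<psi>"
  shows "energy \<psi> \<le> 2 * pairing \<psi> (\<lambda>u. \<psi> u - step \<psi> u)"
proof -
  let ?g = "\<lambda>u w. if w \<in> nb u then \<psi> u * (\<psi> u - \<psi> w) else 0"
  have "(\<Sum>u\<in>B. \<Sum>w\<in>nb u. \<psi> w * (\<psi> w - \<psi> u)) = (\<Sum>u\<in>B. \<Sum>w\<in>B. ?g w u)"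
  proof (rule sum.cong [OF refl])
    fix u assume "u \<in> B"
    have "(\<Sum>w\<in>B. ?g w u) = (\<Sum>w\<in>B. if w \<in> nb u then \<psi> w * (\<psi> w - \<psi> u) else 0)"
      by (intro sum.cong refl) (use nb_sym in auto)
    also have "\<dots> = (\<Sum>w\<in>B \<inter> nb u. \<psi> w * (\<psi> w - \<psi> u))"
      by (simp add: sum.If_cases finite_B Collect_conj_eq)
    also have "\<dots> = (\<Sum>w\<in>nb u. \<psi> w * (\<psi> w - \<psi> u))"
      by (rule sum.mono_neutral_left) (use assms in \<open>auto simp: finite_nb vanishing_def\<close>)
    finally show "(\<Sum>w\<in>nb u. \<psi> w * (\<psi> w - \<psi> u)) = (\<Sum>w\<in>B. ?g w u)" by simp
  qed
  also have "\<dots> = (\<Sum>u\<in>B. \<Sum>w\<in>B. ?g u w)"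
    by (rule sum.swap)
  also have "\<dots> \<le> (\<Sum>u\<in>B. \<Sum>w\<in>nb u. \<psi> u * (\<psi> u - \<psi> w))"
  proof (rule sum_mono)
    fix u assume "u \<in> B"
    have "(\<Sum>w\<in>B. ?g u w) = (\<Sum>w\<in>B \<inter> nb u. \<psi> u * (\<psi> u - \<psi> w))"
      by (simp add: sum.If_cases finite_B Collect_conj_eq)
    also have "\<dots> \<le> (\<Sum>w\<in>nb u. \<psi> u * (\<psi> u - \<psi> w))"
      by (rule sum_mono2) (use assms in \<open>auto simp: finite_nb vanishing_def\<close>)
    finally show "(\<Sum>w\<in>B. ?g u w) \<le> (\<Sum>w\<in>nb u. \<psi> u * (\<psi> u - \<psi> w))" .
  qed
  finally have "(\<Sum>u\<in>B. \<Sum>w\<in>nb u. \<psi> w * (\<psi> w - \<psi> u)) \<le> pairing \<psi> (\<lambda>u. \<psi> u - step \<psi> u)"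
    by (simp add: pairing_laplacian)
  moreover have "energy \<psi> = pairing \<psi> (\<lambda>u. \<psi> u - step \<psi> u)
      + (\<Sum>u\<in>B. \<Sum>w\<in>nb u. \<psi> w * (\<psi> w - \<psi> u))"
    unfolding energy_def pairing_laplacian sum.distrib[symmetric]
    by (intro sum.cong refl) (simp add: power2_eq_square algebra_simps)
  ultimately show ?thesis by simp
qed

text \<open>An upper bound for the effective resistance between \<open>x\<close> and \<open>y\<close>, in the form dual to the usual
  definition; a vertex outside \<open>B\<close> is grounded because \<open>vanishing\<close> functions are zero there.\<close>
definition resistance_le :: "'a \<Rightarrow> 'a \<Rightarrow> real \<Rightarrow> bool" where
  "resistance_le x y r \<longleftrightarrow> 0 \<le> r \<and> (\<forall>\<psi>. vanishing \<psi> \<longrightarrow> (\<psi> x - \<psi> y)\<^sup>2 \<le> r * energy \<psi>)"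

lemma energy_nonneg: "energy \<psi> \<ge> 0"
  by (simp add: energy_def sum_nonneg)

lemma resistance_le_mono: "resistance_le x y r \<Longrightarrow> r \<le> r' \<Longrightarrow> resistance_le x y r'"
  unfolding resistance_le_def by (meson energy_nonneg mult_right_mono order_trans)

lemma resistance_le_trans:
  assumes "resistance_le x y r" "resistance_le y z r'"
  shows "resistance_le x z (2 * (r + r'))"
  unfolding resistance_le_def
proof (intro conjI allI impI)
  fix \<psi> assume v: "vanishing \<psi>"
  have "(\<psi> x - \<psi> z)\<^sup>2 \<le> 2 * ((\<psi> x - \<psi> y)\<^sup>2 + (\<psi> y - \<psi> z)\<^sup>2)"
    using zero_le_power2[of "\<psi> x - 2 * \<psi> y + \<psi> z"]
    by (simp add: power2_eq_square algebra_simps)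
  also have "\<dots> \<le> 2 * (r * energy \<psi> + r' * energy \<psi>)"
    using assms v by (intro mult_left_mono add_mono) (auto simp: resistance_le_def)
  finally show "(\<psi> x - \<psi> z)\<^sup>2 \<le> 2 * (r + r') * energy \<psi>" by (simp add: algebra_simps)
qed (use assms in \<open>auto simp: resistance_le_def\<close>)

lemma resistance_le_path:
  assumes inj: "inj_on z {..<l}"
    and B: "\<And>i. i < l \<Longrightarrow> z i \<in> B" and nb: "\<And>i. i < l \<Longrightarrow> z (Suc i) \<in> nb (z i)"
  shows "resistance_le (z 0) (z l) (real l)"
  unfolding resistance_le_def
proof (intro conjI allI impI)
  fix \<psi> assume v: "vanishing \<psi>"
  have "(\<psi> (z 0) - \<psi> (z l))\<^sup>2 = (\<Sum>i<l. 1 * (\<psi> (z i) - \<psi> (z (Suc i))))\<^sup>2"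
    using sum_lessThan_telescope'[of "\<lambda>i. \<psi> (z i)" l] by simp
  also have "\<dots> \<le> (\<Sum>i<l. 1\<^sup>2) * (\<Sum>i<l. (\<psi> (z i) - \<psi> (z (Suc i)))\<^sup>2)"
    by (rule Cauchy_Schwarz_ineq_sum)
  also have "(\<Sum>i<l. (\<psi> (z i) - \<psi> (z (Suc i)))\<^sup>2) \<le> (\<Sum>i<l. \<Sum>w\<in>nb (z i). (\<psi> (z i) - \<psi> w)\<^sup>2)"
  proof (rule sum_mono)
    fix i assume "i \<in> {..<l}"
    then show "(\<psi> (z i) - \<psi> (z (Suc i)))\<^sup>2 \<le> (\<Sum>w\<in>nb (z i). (\<psi> (z i) - \<psi> w)\<^sup>2)"
      by (intro member_le_sum[where f = "\<lambda>w. (\<psi> (z i) - \<psi> w)\<^sup>2"]) (auto simp: nb finite_nb)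
  qed
  also have "\<dots> = (\<Sum>u\<in>z ` {..<l}. \<Sum>w\<in>nb u. (\<psi> u - \<psi> w)\<^sup>2)"
    by (simp add: sum.reindex[OF inj])
  also have "\<dots> \<le> energy \<psi>"
    unfolding energy_def by (rule sum_mono2) (auto simp: finite_B B sum_nonneg)
  finally show "(\<psi> (z 0) - \<psi> (z l))\<^sup>2 \<le> real l * energy \<psi>"
    by (simp add: mult_left_mono)
qed simp

text \<open>Let \<open>\<phi>\<close> be the difference of the point densities at \<open>x\<close> and \<open>y\<close>, and \<open>\<psi>\<close> its potential. The sum
  \<open>s\<close> of the squared norms is \<open>pairing \<phi> \<psi> = \<psi> x - \<psi> y\<close> by parity and self-adjointness, while the
  energy of \<open>\<psi>\<close> is at most \<open>2 * s\<close>, since cutting off the series only removes a nonnegative term. The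
  resistance bound turns this into \<open>s\<^sup>2 \<le> 2 * r * s\<close>.\<close>
lemma sum_norm_le_resistance:
  assumes r: "resistance_le x y r" and par: "par x = par y \<or> x \<notin> B \<or> y \<notin> B"
  shows "(\<Sum>n<T. pairing (\<lambda>u. heat n x u - heat n y u) (\<lambda>u. heat n x u - heat n y u)) \<le> 2 * r"
proof -
  define \<phi> where "\<phi> = (\<lambda>u. point x u - point y u)"
  define \<psi> where "\<psi> = potential T \<phi>"
  define s where "s = (\<Sum>n<T. pairing ((step ^^ n) \<phi>) ((step ^^ n) \<phi>))"
  have v: "vanishing \<phi>"
    unfolding \<phi>_def by (intro vanishing_diff) simp_all
  have v': "vanishing \<psi>"
    unfolding \<psi>_def by (rule vanishing_potential[OF v])
  obtain c where c: "\<And>u. \<phi> u \<noteq> 0 \<Longrightarrow> par u = c"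
  proof (cases "x \<in> B")
    case True
    then show ?thesis
      using par by (intro that[of "par x"]) (auto simp: \<phi>_def point_def split: if_splits)
  next
    case False
    then show ?thesis
      using par by (intro that[of "par y"]) (auto simp: \<phi>_def point_def split: if_splits)
  qed
  have s: "s = pairing \<phi> \<psi>"
    unfolding s_def \<psi>_def by (rule pairing_potential[OF v c, symmetric])
  \<comment> \<open>The error of the truncation at \<open>2 * T\<close> has a sign: odd powers vanish and even ones are squared norms.\<close>
  have "0 \<le> pairing \<psi> ((step ^^ (2 * T)) \<phi>)"
  proof -
    have "pairing \<psi> ((step ^^ (2 * T)) \<phi>) = (\<Sum>n<2 * T. pairing \<phi> ((step ^^ (n + 2 * T)) \<phi>))"
      unfolding \<psi>_def potential_def[abs_def] pairing_sum_left
      by (simp add: iterate_self_adjoint v vanishing_iterate funpow_add)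
    also have "\<dots> \<ge> 0"
    proof (rule sum_nonneg)
      fix n
      show "0 \<le> pairing \<phi> ((step ^^ (n + 2 * T)) \<phi>)"
      proof (cases "even n")
        case True
        then obtain k where "n + 2 * T = 2 * k" by (auto elim!: evenE intro: that[of "_ + T"])
        then show ?thesis using pairing_iterate_even[OF v, of k] pairing_self_nonneg by simp
      next
        case False
        then show ?thesis using pairing_iterate_odd[of \<phi> c "n + 2 * T"] c by simp
      qed
    qed
    finally show ?thesis .
  qed
  moreover have "pairing \<psi> (\<lambda>u. \<psi> u - step \<psi> u) = pairing \<psi> \<phi> - pairing \<psi> ((step ^^ (2 * T)) \<phi>)"
    unfolding \<psi>_def potential_step pairing_diff_right ..
  ultimately have "pairing \<psi> (\<lambda>u. \<psi> u - step \<psi> u) \<le> s"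
    by (simp add: s pairing_commute)
  then have e: "energy \<psi> \<le> 2 * s"
    using energy_le[OF v'] by simp
  have "s = \<psi> x - \<psi> y"
    unfolding s \<phi>_def pairing_diff_left by (simp add: pairing_point v')
  then have "s\<^sup>2 \<le> r * energy \<psi>"
    using r v' by (simp add: resistance_le_def)
  also have "\<dots> \<le> r * (2 * s)"
    using e r by (intro mult_left_mono) (auto simp: resistance_le_def)
  finally have *: "s * s \<le> (2 * r) * s"
    by (simp add: power2_eq_square algebra_simps)
  have "s \<ge> 0"
    unfolding s_def by (intro sum_nonneg pairing_self_nonneg)
  moreover have "0 \<le> r"
    using r by (simp add: resistance_le_def)
  ultimately have "s \<le> 2 * r"
    using * by (cases "s = 0") (auto simp: mult_le_cancel_right)
  then show ?thesis
    unfolding s_def \<phi>_def heat_def iterate_diff .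
qed

section \<open>Expected collisions of two killed walks\<close>
lemma iterate_nonneg: "(\<And>u. 0 \<le> \<phi> u) \<Longrightarrow> 0 \<le> (step ^^ n) \<phi> u"
proof (induction n arbitrary: u)
  case (Suc n)
  then have "0 \<le> step ((step ^^ n) \<phi>) u"
    unfolding step_def by (auto intro!: divide_nonneg_nonneg sum_nonneg deg_nonneg)
  then show ?case by simp
qed simp

lemma vanishing_heat: "vanishing (heat n x)"
  unfolding heat_def by (rule vanishing_iterate) simp

lemma heat_outside: "x \<notin> B \<Longrightarrow> heat n x u = 0"
proof -
  assume "x \<notin> B"
  then have "point x = (\<lambda>u. 0 * (\<Sum>i\<in>{}. point x u))" by (auto simp: point_def)
  then have "heat n x = (\<lambda>u. 0 * (\<Sum>i\<in>{}. (step ^^ n) (point x) u))"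
    unfolding heat_def using iterate_cmult_sum[of n 0 "\<lambda>_. point x" "{}"] by simp
  then show ?thesis by simp
qed

lemma heat_Suc: "heat (Suc n) x = step (heat n x)"
  by (simp add: heat_def)

text \<open>The definition iterates the walk in the variable \<open>u\<close>. By symmetry of the kernel the first step may
  equally be taken at the starting point.\<close>
lemma heat_Suc_start:
  assumes x: "x \<in> B"
  shows "heat (Suc n) x u = (\<Sum>w\<in>nb x. heat n w u) / deg x"
proof -
  have "step (point x) = (\<lambda>u. 1 / deg x * (\<Sum>w\<in>nb x. point w u))"
  proof
    fix u
    have 1: "(\<Sum>w\<in>nb u. point x w) = (if x \<in> nb u then 1 / deg x else 0)"
      using x finite_nb by (simp add: point_def)
    have 2: "(\<Sum>w\<in>nb x. point w u) = (if u \<in> nb x \<and> u \<in> B then 1 / deg u else 0)"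
    proof -
      have "(\<Sum>w\<in>nb x. point w u) = (\<Sum>w\<in>nb x. if u = w then (if u \<in> B then 1 / deg u else 0) else 0)"
        by (intro sum.cong refl) (auto simp: point_def)
      then show ?thesis using finite_nb by simp
    qed
    show "step (point x) u = 1 / deg x * (\<Sum>w\<in>nb x. point w u)"
      using nb_sym[of x u] nb_sym[of u x] by (auto simp: step_def 1 2)
  qed
  moreover have "heat (Suc n) x = (step ^^ n) (step (point x))"
    by (simp add: heat_def funpow_swap1)
  ultimately have "heat (Suc n) x = (\<lambda>u. 1 / deg x * (\<Sum>w\<in>nb x. heat n w u))"
    by (simp only: iterate_cmult_sum heat_def)
  then show ?thesis by simp
qed

text \<open>The expected number of meetings in \<open>A\<close> before time \<open>T\<close> of two independent killed walks from \<open>x\<close> and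
  \<open>y\<close>, where a meeting at \<open>u\<close> has weight \<open>1 / deg u\<close>. This weight makes \<open>overlap A T\<close> a positive
  semidefinite form dominated by the one for \<open>A = B\<close>, which is the sum over time of the pairings of the
  two heat kernels.\<close>
definition overlap :: "'a set \<Rightarrow> nat \<Rightarrow> 'a \<Rightarrow> 'a \<Rightarrow> real" where
  "overlap A T x y = (\<Sum>n<T. \<Sum>u\<in>A. deg u * (heat n x u * heat n y u))"

lemma overlap_outside: "x \<notin> B \<or> y \<notin> B \<Longrightarrow> overlap A T x y = 0"
  by (auto simp: overlap_def heat_outside)

lemma overlap_Suc:
  assumes A: "A \<subseteq> B" and x: "x \<in> B" and y: "y \<in> B"
  shows "overlap A (Suc T) x y = (if x = y \<and> x \<in> A then 1 / deg x else 0)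
    + (\<Sum>w\<in>nb x. \<Sum>z\<in>nb y. overlap A T w z) / (deg x * deg y)"
proof -
  have fin: "finite A" using A finite_B finite_subset by blast
  have "overlap A (Suc T) x y = (\<Sum>u\<in>A. deg u * (heat 0 x u * heat 0 y u))
      + (\<Sum>n<T. \<Sum>u\<in>A. deg u * (heat (Suc n) x u * heat (Suc n) y u))"
    unfolding overlap_def by (rule sum.lessThan_Suc_shift)
  moreover have "(\<Sum>u\<in>A. deg u * (heat 0 x u * heat 0 y u)) = (if x = y \<and> x \<in> A then 1 / deg x else 0)"
  proof -
    have "(\<Sum>u\<in>A. deg u * (heat 0 x u * heat 0 y u)) = (\<Sum>u\<in>A. if u = x then (if x = y then 1 / deg x else 0) else 0)"
      by (intro sum.cong refl) (use x y deg_pos[OF x] in \<open>auto simp: heat_def point_def\<close>)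
    then show ?thesis using fin by simp
  qed
  moreover have "(\<Sum>n<T. \<Sum>u\<in>A. deg u * (heat (Suc n) x u * heat (Suc n) y u))
      = (\<Sum>w\<in>nb x. \<Sum>z\<in>nb y. overlap A T w z) / (deg x * deg y)"
  proof -
    have "(\<Sum>w\<in>nb x. \<Sum>z\<in>nb y. overlap A T w z)
        = (\<Sum>w\<in>nb x. \<Sum>n<T. \<Sum>z\<in>nb y. \<Sum>u\<in>A. deg u * (heat n w u * heat n z u))"
      unfolding overlap_def by (intro sum.cong refl sum.swap)
    also have "\<dots> = (\<Sum>n<T. \<Sum>w\<in>nb x. \<Sum>z\<in>nb y. \<Sum>u\<in>A. deg u * (heat n w u * heat n z u))"
      by (rule sum.swap)
    also have "\<dots> = (\<Sum>n<T. \<Sum>u\<in>A. deg u * ((\<Sum>w\<in>nb x. heat n w u) * (\<Sum>z\<in>nb y. heat n z u)))"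
    proof (rule sum.cong [OF refl])
      fix n
      have "(\<Sum>w\<in>nb x. \<Sum>z\<in>nb y. \<Sum>u\<in>A. deg u * (heat n w u * heat n z u))
          = (\<Sum>w\<in>nb x. \<Sum>u\<in>A. \<Sum>z\<in>nb y. deg u * (heat n w u * heat n z u))"
        by (intro sum.cong refl sum.swap)
      also have "\<dots> = (\<Sum>u\<in>A. \<Sum>w\<in>nb x. \<Sum>z\<in>nb y. deg u * (heat n w u * heat n z u))"
        by (rule sum.swap)
      also have "\<dots> = (\<Sum>u\<in>A. deg u * ((\<Sum>w\<in>nb x. heat n w u) * (\<Sum>z\<in>nb y. heat n z u)))"
        by (simp only: sum_product, simp only: sum_distrib_left)
      finally show "(\<Sum>w\<in>nb x. \<Sum>z\<in>nb y. \<Sum>u\<in>A. deg u * (heat n w u * heat n z u)) = \<dots>" .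
    qed
    finally show ?thesis
      unfolding heat_Suc_start[OF x] heat_Suc_start[OF y] by (simp add: sum_divide_distrib[symmetric])
  qed
  ultimately show ?thesis by simp
qed

text \<open>The overlap is harmonic for the pair of walks except at the points \<open>(a, a)\<close> with \<open>a \<in> A\<close>, and it
  is zero as soon as one of them starts outside \<open>B\<close>. So it is largest at these points.\<close>
lemma overlap_maximum:
  assumes A: "A \<subseteq> B" and M: "0 \<le> M" "\<And>T a. a \<in> A \<Longrightarrow> overlap A T a a \<le> M"
  shows "overlap A T x y \<le> M"
proof (induction T arbitrary: x y)
  case 0
  show ?case using M(1) by (simp add: overlap_def)
next
  case (Suc T)
  show ?case
  proof (cases "x \<in> B \<and> y \<in> B \<and> \<not> (x = y \<and> x \<in> A)")
    case True
    then have "overlap A (Suc T) x y = (\<Sum>w\<in>nb x. \<Sum>z\<in>nb y. overlap A T w z) / (deg x * deg y)"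
      by (subst overlap_Suc[OF A]) auto
    also have "\<dots> \<le> (\<Sum>w\<in>nb x. \<Sum>z\<in>nb y. M) / (deg x * deg y)"
      by (intro divide_right_mono sum_mono Suc.IH mult_nonneg_nonneg deg_nonneg)
    also have "\<dots> = M"
      using True deg_pos[of x] deg_pos[of y] by (simp add: deg_def)
    finally show ?thesis .
  next
    case False
    then show ?thesis
      using M overlap_outside[of x y A "Suc T"] by auto
  qed
qed

text \<open>The function \<open>\<sigma> * (1 - overlap A T x y / M)\<close> dominates \<open>s\<close> outside \<open>B\<close>, where the overlap is zero,
  and on the diagonal, where \<open>s\<close> is zero and the overlap at most \<open>M\<close>. Off the diagonal the overlap at
  time \<open>T + 1\<close> is the average of the overlap at time \<open>T\<close> over the neighbouring pairs, and \<open>s\<close> is at most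
  its own average. For the probability \<open>s\<close> of never meeting, this bounds the chance of a meeting from
  below by the overlap divided by \<open>M\<close>.\<close>
lemma avoidance_le_overlap:
  assumes A: "A \<subseteq> B"
    and M: "0 < M" "\<And>T a. a \<in> A \<Longrightarrow> overlap A T a a \<le> M"
    and C: "\<And>u w. u \<in> B \<Longrightarrow> w \<in> nb u \<Longrightarrow> w \<in> C"
    and s_le: "\<And>x y. x \<in> C \<Longrightarrow> y \<in> C \<Longrightarrow> par x = par y \<Longrightarrow> s x y \<le> \<sigma>"
    and s_diag: "\<And>x. x \<in> B \<Longrightarrow> s x x = 0"
    and s_step: "\<And>x y. x \<in> B \<Longrightarrow> y \<in> B \<Longrightarrow> x \<noteq> y \<Longrightarrow>
        s x y \<le> (\<Sum>w\<in>nb x. \<Sum>z\<in>nb y. s w z) / (deg x * deg y)"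
    and \<sigma>: "0 \<le> \<sigma>"
    and xy: "x \<in> C" "y \<in> C" "par x = par y"
  shows "s x y \<le> \<sigma> * (1 - overlap A T x y / M)"
  using xy
proof (induction T arbitrary: x y)
  case 0
  then show ?case using s_le by (simp add: overlap_def)
next
  case (Suc T)
  show ?case
  proof (cases "x \<in> B \<and> y \<in> B")
    case True
    then have B: "x \<in> B" "y \<in> B" by auto
    note pos = deg_pos[OF B(1)] deg_pos[OF B(2)]
    show ?thesis
    proof (cases "x = y")
      case True
      have "overlap A (Suc T) x x \<le> M"
        by (rule overlap_maximum[OF A _ M(2)]) (use M(1) in auto)
      then show ?thesis
        using True M(1) \<sigma> s_diag[OF B(1)] by (simp add: mult_nonneg_nonneg)
    next
      case False
      have "s x y \<le> (\<Sum>w\<in>nb x. \<Sum>z\<in>nb y. s w z) / (deg x * deg y)"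
        by (rule s_step[OF B False])
      also have "\<dots> \<le> (\<Sum>w\<in>nb x. \<Sum>z\<in>nb y. \<sigma> * (1 - overlap A T w z / M)) / (deg x * deg y)"
      proof (intro divide_right_mono sum_mono mult_nonneg_nonneg deg_nonneg)
        fix w z assume wz: "w \<in> nb x" "z \<in> nb y"
        show "s w z \<le> \<sigma> * (1 - overlap A T w z / M)"
          using C[OF B(1) wz(1)] C[OF B(2) wz(2)] par_nb[OF wz(1)] par_nb[OF wz(2)] Suc.prems(3)
          by (intro Suc.IH) auto
      qed
      also have "\<dots> = \<sigma> * (1 - (\<Sum>w\<in>nb x. \<Sum>z\<in>nb y. overlap A T w z) / (deg x * deg y) / M)"
      proof -
        have "(\<Sum>w\<in>nb x. \<Sum>z\<in>nb y. \<sigma> * (1 - overlap A T w z / M))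
            = \<sigma> * (deg x * deg y) - \<sigma> * ((\<Sum>w\<in>nb x. \<Sum>z\<in>nb y. overlap A T w z) / M)"
          by (simp add: right_diff_distrib sum_subtractf deg_def sum_divide_distrib sum_distrib_left)
        then show ?thesis using pos M(1) by (simp add: field_simps)
      qed
      also have "\<dots> = \<sigma> * (1 - overlap A (Suc T) x y / M)"
        using overlap_Suc[OF A B] False by simp
      finally show ?thesis .
    qed
  next
    case False
    then show ?thesis
      using s_le[OF Suc.prems] overlap_outside[of x y A "Suc T"] by auto
  qed
qed

lemma overlap_diff_le:
  assumes A: "A \<subseteq> B" and r: "resistance_le x y r" and par: "par x = par y \<or> x \<notin> B \<or> y \<notin> B"
  shows "(\<Sum>n<T. \<Sum>u\<in>A. deg u * (heat n x u - heat n y u)\<^sup>2) \<le> 2 * r"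
proof -
  have "(\<Sum>n<T. \<Sum>u\<in>A. deg u * (heat n x u - heat n y u)\<^sup>2)
      \<le> (\<Sum>n<T. \<Sum>u\<in>B. deg u * (heat n x u - heat n y u)\<^sup>2)"
    by (intro sum_mono sum_mono2 A finite_B) (simp add: deg_nonneg)
  also have "\<dots> \<le> 2 * r"
    using sum_norm_le_resistance[OF r par, of T] by (simp add: pairing_def power2_eq_square)
  finally show ?thesis .
qed

lemma overlap_self_le:
  assumes A: "A \<subseteq> B" and r: "resistance_le x y r" and y: "y \<notin> B"
  shows "overlap A T x x \<le> 2 * r"
  using overlap_diff_le[OF A r, of T] y by (simp add: overlap_def heat_outside power2_eq_square)

text \<open>The overlap is an inner product, and the squared distance of \<open>x\<close> and \<open>y\<close> from \<open>src\<close> in it is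
  controlled by resistances. The constants come from the pointwise inequality in the proof, which
  replaces the triangle inequality.\<close>
lemma overlap_comparison:
  assumes A: "A \<subseteq> B"
    and x: "resistance_le x src r" "par x = par src" and y: "resistance_le y src r'" "par y = par src"
  shows "overlap A T x y \<ge> 3 / 4 * overlap A T src src - 5 * (r + r')"
proof -
  let ?d = "\<lambda>x. \<Sum>n<T. \<Sum>u\<in>A. deg u * (heat n x u - heat n src u)\<^sup>2"
  have pt: "3 / 4 * (c * c) - 5 / 2 * ((a - c)\<^sup>2 + (b - c)\<^sup>2) \<le> a * b" for a b c :: real
  proof -
    have "a * b - (3 / 4 * (c * c) - 5 / 2 * ((a - c)\<^sup>2 + (b - c)\<^sup>2))
        = (c / 2 + (a - c) + (b - c))\<^sup>2 + 3 / 2 * (a - c)\<^sup>2 + 3 / 2 * (b - c)\<^sup>2 - (a - c) * (b - c)"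
      by (simp add: power2_eq_square field_simps)
    moreover have "(a - c) * (b - c) \<le> 3 / 2 * (a - c)\<^sup>2 + 3 / 2 * (b - c)\<^sup>2"
      using sum_squares_bound[of "a - c" "b - c"] zero_le_power2[of "a - c"] zero_le_power2[of "b - c"] by linarith
    ultimately show ?thesis
      using zero_le_power2[of "c / 2 + (a - c) + (b - c)"] by linarith
  qed
  have "3 / 4 * overlap A T src src - 5 / 2 * (?d x + ?d y)
      = (\<Sum>n<T. \<Sum>u\<in>A. deg u * (3 / 4 * (heat n src u * heat n src u)
          - 5 / 2 * ((heat n x u - heat n src u)\<^sup>2 + (heat n y u - heat n src u)\<^sup>2)))"
    by (simp add: overlap_def sum_distrib_left sum_subtractf sum.distrib algebra_simps)
  also have "\<dots> \<le> overlap A T x y"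
    unfolding overlap_def by (intro sum_mono mult_left_mono pt deg_nonneg)
  finally show ?thesis
    using overlap_diff_le[OF A x(1) disjI1[OF x(2)], of T] overlap_diff_le[OF A y(1) disjI1[OF y(2)], of T]
    by argo
qed

lemma heat_tendsto_0:
  assumes r: "resistance_le x y r" and y: "y \<notin> B"
  shows "(\<lambda>n. heat n x u) \<longlonglongrightarrow> 0"
proof (cases "u \<in> B")
  case True
  have "summable (\<lambda>n. deg u * (heat n x u)\<^sup>2)"
  proof (rule bounded_imp_summable)
    fix n
    have "(\<Sum>k\<le>n. deg u * (heat k x u)\<^sup>2) \<le> (\<Sum>k<Suc n. \<Sum>w\<in>B. deg w * (heat k x w)\<^sup>2)"
      unfolding lessThan_Suc_atMost
      by (intro sum_mono member_le_sum[of u B "\<lambda>w. deg w * (heat _ x w)\<^sup>2"] True finite_B)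
        (simp add: deg_nonneg)
    also have "\<dots> \<le> 2 * r"
      using overlap_diff_le[OF order_refl r, of "Suc n"] y by (simp add: heat_outside)
    finally show "(\<Sum>k\<le>n. deg u * (heat k x u)\<^sup>2) \<le> 2 * r" .
  qed (simp add: deg_nonneg)
  then have "(\<lambda>n. deg u * (heat n x u)\<^sup>2) \<longlonglongrightarrow> 0"
    by (rule summable_LIMSEQ_zero)
  then have "(\<lambda>n. (deg u * (heat n x u)\<^sup>2) / deg u) \<longlonglongrightarrow> 0 / deg u"
    by (intro tendsto_divide tendsto_const) (use deg_pos[OF True] in auto)
  then have "(\<lambda>n. (heat n x u)\<^sup>2) \<longlonglongrightarrow> 0"
    using deg_pos[OF True] by simp
  then show ?thesis
    by simp
next
  case False
  then show ?thesis using vanishing_heat by (simp add: vanishing_def)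
qed

text \<open>If \<open>\<eta>\<close> has nonpositive Laplacian away from \<open>src\<close>, then pairing the Laplacian of \<open>\<eta>\<close> with the
  potential of the point density at \<open>src\<close> gives at most \<open>c\<close> times the Green function at \<open>src\<close>. By
  self-adjointness it also equals \<open>\<eta> src = 1\<close> up to the truncation error, which tends to zero because
  the heat kernel does.\<close>
lemma norm_sum_ge_tent:
  assumes src: "src \<in> B" and r: "resistance_le src y r" and y: "y \<notin> B"
    and \<eta>: "vanishing \<eta>" "\<eta> src = 1"
    and lap: "\<And>u. u \<in> B \<Longrightarrow> (\<Sum>w\<in>nb u. \<eta> u - \<eta> w) \<le> (if u = src then c else 0)"
  shows "\<exists>T. 1 / 2 \<le> c * (\<Sum>n<T. pairing (heat n src) (heat n src))"
proof -
  have "(\<lambda>n. pairing (heat n src) \<eta>) \<longlonglongrightarrow> (\<Sum>u\<in>B. deg u * (0 * \<eta> u))"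
    unfolding pairing_def by (intro tendsto_intros heat_tendsto_0[OF r y])
  then have "eventually (\<lambda>n. pairing (heat n src) \<eta> < 1 / 2) sequentially"
    by (intro order_tendstoD(2)) auto
  then obtain T where T: "\<And>n. n \<ge> T \<Longrightarrow> pairing (heat n src) \<eta> < 1 / 2"
    by (auto simp: eventually_sequentially)
  define \<psi> where "\<psi> = potential T (point src)"
  have v: "vanishing \<psi>"
    unfolding \<psi>_def by (rule vanishing_potential) simp
  have \<psi>: "0 \<le> \<psi> u" for u
    unfolding \<psi>_def potential_def
    by (intro sum_nonneg iterate_nonneg) (simp add: point_def deg_nonneg)
  have \<psi>src: "\<psi> src = (\<Sum>n<T. pairing (heat n src) (heat n src))"
    unfolding heat_def
    by (subst pairing_potential[symmetric, where c = "par src"])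
      (auto simp: \<psi>_def[symmetric] pairing_point v, auto simp: point_def split: if_splits)
  have "pairing \<psi> (\<lambda>u. \<eta> u - step \<eta> u) = pairing (\<lambda>u. \<psi> u - step \<psi> u) \<eta>"
    unfolding pairing_diff_left pairing_diff_right using step_self_adjoint[OF v \<eta>(1)] by simp
  also have "\<dots> = 1 - pairing (heat (2 * T) src) \<eta>"
    unfolding \<psi>_def potential_step pairing_diff_left heat_def by (simp add: pairing_point \<eta>)
  finally have "1 / 2 \<le> pairing \<psi> (\<lambda>u. \<eta> u - step \<eta> u)"
    using T[of "2 * T"] by simp
  also have "\<dots> = (\<Sum>u\<in>B. \<psi> u * (\<Sum>w\<in>nb u. \<eta> u - \<eta> w))"
    unfolding pairing_laplacian by (simp add: sum_distrib_left)
  also have "\<dots> \<le> (\<Sum>u\<in>B. \<psi> u * (if u = src then c else 0))"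
    by (intro sum_mono mult_left_mono lap \<psi>)
  also have "\<dots> = (\<Sum>u\<in>B. if u = src then c * \<psi> src else 0)"
    by (intro sum.cong) auto
  also have "\<dots> = c * \<psi> src"
    using src finite_B by simp
  finally show ?thesis unfolding \<psi>src by blast
qed

definition heat_square :: "'a \<Rightarrow> nat \<Rightarrow> 'a \<Rightarrow> real" where
  "heat_square src T u = (\<Sum>n<T. (heat n src u)\<^sup>2)"

lemma heat_square_nonneg: "0 \<le> heat_square src T u"
  by (simp add: heat_square_def sum_nonneg)

lemma heat_square_outside: "u \<notin> B \<Longrightarrow> heat_square src T u = 0"
  using vanishing_heat by (simp add: heat_square_def vanishing_def)

text \<open>The heat kernel at time \<open>n + 1\<close> is the average of the kernel at time \<open>n\<close> over the neighbours, and squaring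
  is convex. The exception at \<open>src\<close> comes from time zero.\<close>
lemma heat_square_subharmonic:
  assumes u: "u \<in> B" "u \<noteq> src"
  shows "deg u * heat_square src T u \<le> (\<Sum>w\<in>nb u. heat_square src T w)"
proof (cases T)
  case 0
  then show ?thesis by (simp add: heat_square_def)
next
  case (Suc k)
  have "heat_square src T u = (\<Sum>n<k. (heat (Suc n) src u)\<^sup>2)"
    unfolding heat_square_def Suc sum.lessThan_Suc_shift
    using u(2) by (simp add: heat_def point_def)
  then have "deg u * heat_square src T u = (\<Sum>n<k. deg u * (heat (Suc n) src u)\<^sup>2)"
    by (simp add: sum_distrib_left)
  also have "\<dots> \<le> (\<Sum>n<k. \<Sum>w\<in>nb u. (heat n src w)\<^sup>2)"
  proof (rule sum_mono)
    fix n
    have "(\<Sum>w\<in>nb u. 1 * heat n src w)\<^sup>2 \<le> (\<Sum>w\<in>nb u. 1\<^sup>2) * (\<Sum>w\<in>nb u. (heat n src w)\<^sup>2)"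
      by (rule Cauchy_Schwarz_ineq_sum)
    then have "(\<Sum>w\<in>nb u. heat n src w)\<^sup>2 \<le> deg u * (\<Sum>w\<in>nb u. (heat n src w)\<^sup>2)"
      by (simp add: deg_def)
    then show "deg u * (heat (Suc n) src u)\<^sup>2 \<le> (\<Sum>w\<in>nb u. (heat n src w)\<^sup>2)"
      using u(1) deg_pos[OF u(1)]
      by (simp add: heat_Suc step_def power2_eq_square field_simps)
  qed
  also have "\<dots> = (\<Sum>w\<in>nb u. \<Sum>n<k. (heat n src w)\<^sup>2)"
    by (rule sum.swap)
  also have "\<dots> \<le> (\<Sum>w\<in>nb u. heat_square src T w)"
    unfolding heat_square_def Suc by (intro sum_mono sum_mono2) auto
  finally show ?thesis .
qed

end

section \<open>Boxes in the wedge comb\<close>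
abbreviation comb_nb :: "(int \<Rightarrow> real) \<Rightarrow> int \<times> int \<Rightarrow> (int \<times> int) set" where
  "comb_nb f \<equiv> neighbours (comb_verts f) (comb_edges f)"

definition par :: "int \<times> int \<Rightarrow> bool" where
  "par u \<longleftrightarrow> even (fst u + snd u)"

definition box :: "(int \<Rightarrow> real) \<Rightarrow> nat \<Rightarrow> (int \<times> int) set" where
  "box f N = {u \<in> comb_verts f. \<bar>fst u\<bar> \<le> int N}"

lemma comb_nb_iff:
  "(x', y') \<in> comb_nb f (x, y) \<longleftrightarrow> (x, y) \<in> comb_verts f \<and> (x', y') \<in> comb_verts f \<and>
     (x' = x \<and> \<bar>y' - y\<bar> = 1 \<or> y = 0 \<and> y' = 0 \<and> \<bar>x' - x\<bar> = 1)"
  (is "?L = ?R")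
proof
  assume ?L
  then show ?R
    by (auto simp: neighbours_def comb_edges_def doubleton_eq_iff)
next
  assume r: ?R
  then have "{(x, y), (x', y')} \<in> comb_edges f"
  proof (elim conjE disjE)
    assume a: "(x, y) \<in> comb_verts f" "(x', y') \<in> comb_verts f" "x' = x" "\<bar>y' - y\<bar> = 1"
    then have "\<exists>x0 n m. {(x, y), (x', y')} = {(x0, n), (x0, m)} \<and>
        (x0, n) \<in> comb_verts f \<and> (x0, m) \<in> comb_verts f \<and> \<bar>m - n\<bar> = 1"
      by blast
    then show ?thesis unfolding comb_edges_def by blast
  next
    assume a: "(x, y) \<in> comb_verts f" "(x', y') \<in> comb_verts f" "y = 0" "y' = 0" "\<bar>x' - x\<bar> = 1"
    then have "\<exists>x0 x1. {(x, y), (x', y')} = {(x0, 0), (x1, 0)} \<and>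
        (x0, 0) \<in> comb_verts f \<and> (x1, 0) \<in> comb_verts f \<and> \<bar>x0 - x1\<bar> = 1"
      by (intro exI[of _ x] exI[of _ x']) (simp add: abs_minus_commute)
    then show ?thesis unfolding comb_edges_def by blast
  qed
  with r show ?L by (simp add: neighbours_def)
qed

lemma comb_verts_iff: "(x, y) \<in> comb_verts f \<longleftrightarrow> \<bar>of_int y\<bar> \<le> f x"
  by (auto simp: comb_verts_def)

lemma comb_nb_sym: "w \<in> comb_nb f u \<Longrightarrow> u \<in> comb_nb f w"
  by (cases u; cases w) (auto simp: comb_nb_iff)

lemma par_comb_nb: "w \<in> comb_nb f u \<Longrightarrow> par w \<noteq> par u"
  by (cases u; cases w) (auto simp: comb_nb_iff par_def, presburger+)

lemma finite_box: "finite (box f N)"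
proof (rule finite_subset)
  show "box f N \<subseteq> (SIGMA x:{- int N..int N}. {- \<lfloor>f x\<rfloor>..\<lfloor>f x\<rfloor>})"
    by (auto simp: box_def comb_verts_def le_floor_iff floor_le_iff) (smt (verit) le_floor_iff of_int_minus)
qed simp

locale comb_box =
  fixes f :: "int \<Rightarrow> real" and N :: nat
  assumes f_nonneg: "0 \<le> f x" and N_ge_2: "2 \<le> N"

sublocale comb_box \<subseteq> killed_walk "comb_nb f" "box f N" par
  by unfold_locales (use finite_box finite_neighbours_comb comb_nb_sym par_comb_nb f_nonneg
      neighbours_comb_nonempty in \<open>auto simp: box_def\<close>)

context comb_box
begin

lemma spine [simp]: "(x, 0) \<in> comb_verts f"
  using f_nonneg by (simp add: comb_verts_iff)

lemma spine_box: "(x, 0) \<in> box f N \<longleftrightarrow> \<bar>x\<bar> \<le> int N"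
  by (simp add: box_def)

lemma resistance_tooth:
  assumes "(x, y) \<in> box f N"
  shows "resistance_le (x, y) (x, 0) \<bar>of_int y\<bar>"
proof -
  define z where "z = (\<lambda>i::nat. (x, y - sgn y * int i))"
  have V: "z i \<in> comb_verts f" if "i \<le> nat \<bar>y\<bar>" for i
  proof -
    have "\<bar>y - sgn y * int i\<bar> \<le> \<bar>y\<bar>"
      using that by (cases y rule: linorder_cases[of _ 0]) auto
    then have "\<bar>of_int (y - sgn y * int i)\<bar> \<le> \<bar>of_int y :: real\<bar>"
      by linarith
    also have "\<dots> \<le> f x"
      using assms by (simp add: box_def comb_verts_iff)
    finally show ?thesis by (simp add: z_def comb_verts_iff)
  qed
  have "resistance_le (z 0) (z (nat \<bar>y\<bar>)) (real (nat \<bar>y\<bar>))"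
  proof (rule resistance_le_path)
    show "inj_on z {..<nat \<bar>y\<bar>}"
      by (auto simp: inj_on_def z_def sgn_if split: if_splits)
  next
    fix i assume i: "i < nat \<bar>y\<bar>"
    show "z i \<in> box f N"
      using V[of i] i assms by (auto simp: box_def z_def)
    show "z (Suc i) \<in> comb_nb f (z i)"
      using V[of i] V[of "Suc i"] i unfolding z_def comb_nb_iff by (auto simp: sgn_if algebra_simps)
  qed
  moreover have "z 0 = (x, y)" "z (nat \<bar>y\<bar>) = (x, 0)"
    by (auto simp: z_def sgn_if)
  ultimately show ?thesis by simp
qed

lemma resistance_spine:
  assumes x: "\<bar>x\<bar> \<le> int N" and x': "\<bar>x'\<bar> \<le> int N + 1"
  shows "resistance_le (x, 0) (x', 0) \<bar>of_int (x - x')\<bar>"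
proof -
  define s where "s = sgn (x' - x)"
  define z where "z = (\<lambda>i::nat. (x + s * int i, 0 :: int))"
  define l where "l = nat \<bar>x' - x\<bar>"
  have "resistance_le (z 0) (z l) (real l)"
  proof (rule resistance_le_path)
    show "inj_on z {..<l}"
      by (auto simp: inj_on_def z_def s_def l_def sgn_if split: if_splits)
  next
    fix i assume i: "i < l"
    show "z i \<in> box f N"
      using i x x' by (auto simp: z_def spine_box s_def l_def sgn_if split: if_splits)
    show "z (Suc i) \<in> comb_nb f (z i)"
      using i unfolding z_def comb_nb_iff by (auto simp: s_def l_def sgn_if algebra_simps)
  qed
  moreover have "z 0 = (x, 0)" "z l = (x', 0)" "real l = \<bar>of_int (x - x')\<bar>"
    by (auto simp: z_def s_def l_def sgn_if)
  ultimately show ?thesis by simp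
qed

lemma resistance_to_spine:
  assumes x: "(x, y) \<in> box f N" and x': "\<bar>x'\<bar> \<le> int N + 1"
  shows "resistance_le (x, y) (x', 0) (2 * (\<bar>of_int y\<bar> + \<bar>of_int (x - x')\<bar>))"
  using resistance_le_trans[OF resistance_tooth[OF x] resistance_spine[OF _ x', of x]] x
  by (simp add: box_def)

text \<open>The resistance from a vertex of height at most \<open>N\<close> to the grounded vertex \<open>(N + 1, 0)\<close> is at most a
  multiple of its distance, which is of order \<open>N\<close>.\<close>
lemma overlap_low_le:
  assumes A: "A \<subseteq> box f N" and u: "u \<in> A" and low: "\<bar>snd u\<bar> \<le> int N"
  shows "overlap A T u u \<le> 16 * real N"
proof -
  obtain x y where u_eq: "u = (x, y)" by (cases u)
  have B: "(x, y) \<in> box f N" using A u u_eq by auto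
  have out: "(int N + 1, 0) \<notin> box f N" by (simp add: spine_box)
  have "overlap A T u u \<le> 2 * (2 * (\<bar>of_int y\<bar> + \<bar>of_int (x - (int N + 1))\<bar>))"
    unfolding u_eq by (rule overlap_self_le[OF A resistance_to_spine[OF B] out]) simp
  also have "\<bar>of_int y\<bar> \<le> real N"
    using low u_eq by simp
  also have "\<bar>of_int (x - (int N + 1))\<bar> \<le> 2 * real N + 1"
  proof -
    have "\<bar>x - (int N + 1)\<bar> \<le> 2 * int N + 1" using B by (auto simp: box_def)
    then show ?thesis by linarith
  qed
  finally show ?thesis using N_ge_2 by simp
qed

lemma deg_le: "deg u \<le> 4"
proof -
  obtain x y where u: "u = (x, y)" by (cases u)
  have "comb_nb f u \<subseteq> {(x - 1, y), (x + 1, y), (x, y - 1), (x, y + 1)}"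
  proof
    fix w assume "w \<in> comb_nb f u"
    then show "w \<in> {(x - 1, y), (x + 1, y), (x, y - 1), (x, y + 1)}"
      unfolding u by (cases w) (auto simp: comb_nb_iff)
  qed
  then have "card (comb_nb f u) \<le> card {(x - 1, y), (x + 1, y), (x, y - 1), (x, y + 1)}"
    by (intro card_mono) auto
  also have "\<dots> \<le> 4" by (simp add: card_insert_if)
  finally show ?thesis by (simp add: deg_def)
qed

lemma deg_ge_1: "u \<in> box f N \<Longrightarrow> 1 \<le> deg u"
  using deg_pos[of u] by (simp add: deg_def Suc_le_eq)

text \<open>On the spine this is, up to a factor, the Green function of the walk on an interval of radius \<open>N\<close>
  around \<open>p\<close>; extended as a constant along the teeth it stays harmonic off the spine.\<close>
definition tent :: "int \<Rightarrow> int \<Rightarrow> real" where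
  "tent p x = max 0 (1 - \<bar>of_int (x - p)\<bar> / real N)"

lemma tent_convex: "x \<noteq> p \<Longrightarrow> 2 * tent p x \<le> tent p (x - 1) + tent p (x + 1)"
proof -
  assume "x \<noteq> p"
  then have "\<bar>x - 1 - p\<bar> + \<bar>x + 1 - p\<bar> \<le> 2 * \<bar>x - p\<bar>"
    by arith
  then have "real_of_int (\<bar>x - 1 - p\<bar> + \<bar>x + 1 - p\<bar>) \<le> real_of_int (2 * \<bar>x - p\<bar>)"
    by (simp only: of_int_le_iff)
  then have "2 * \<bar>of_int (x - p)\<bar> \<ge> \<bar>of_int (x - 1 - p)\<bar> + \<bar>of_int (x + 1 - p) :: real\<bar>"
    by simp
  then have "2 * \<bar>of_int (x - p)\<bar> / real N \<ge> \<bar>of_int (x - 1 - p)\<bar> / real N + \<bar>of_int (x + 1 - p) :: real\<bar> / real N"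
    unfolding add_divide_distrib[symmetric] by (intro divide_right_mono) auto
  moreover have "2 * max 0 (1 - a) \<le> max 0 (1 - b) + max 0 (1 - c)" if "b + c \<le> 2 * a" for a b c :: real
    using that by (auto simp: max_def)
  ultimately show ?thesis unfolding tent_def by simp
qed

text \<open>The centre \<open>p\<close> ranges over two neighbouring spine vertices so that both colour classes are served;
  for either choice the tent is zero on the columns \<open>\<bar>x\<bar> = N + 1\<close>, whence the radius \<open>N\<close> instead of
  \<open>N + 1\<close>.\<close>
lemma norm_sum_ge:
  assumes p: "p \<in> {0, 1}"
  shows "\<exists>T. real N / 4 \<le> (\<Sum>n<T. pairing (heat n (p, 0)) (heat n (p, 0)))"
proof -
  define \<eta> where "\<eta> = (\<lambda>u. if u \<in> box f N then tent p (fst u) else 0)"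
  have \<eta>_spine: "\<eta> (x, 0) = tent p x" if "\<bar>x\<bar> \<le> int N + 1" for x
  proof (cases "\<bar>x\<bar> \<le> int N")
    case False
    then have "\<bar>of_int (x - p)\<bar> \<ge> real N"
      using that p by auto
    then have "1 \<le> \<bar>of_int (x - p)\<bar> / real N"
      using N_ge_2 by (simp add: field_simps)
    then show ?thesis using False by (simp add: \<eta>_def spine_box tent_def)
  qed (simp add: \<eta>_def spine_box)
  have tooth: "\<eta> (x, y) = \<eta> (x, y')" if "(x, y) \<in> comb_verts f" "(x, y') \<in> comb_verts f" for x y y'
    using that by (simp add: \<eta>_def box_def)
  have "\<exists>T. 1 / 2 \<le> 2 / real N * (\<Sum>n<T. pairing (heat n (p, 0)) (heat n (p, 0)))"
  proof (rule norm_sum_ge_tent)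
    show "(p, 0) \<in> box f N" "\<eta> (p, 0) = 1"
      using p N_ge_2 \<eta>_spine[of p] by (auto simp: spine_box tent_def)
    show "resistance_le (p, 0) (int N + 1, 0) \<bar>of_int (p - (int N + 1))\<bar>"
      using p N_ge_2 by (intro resistance_spine) auto
    show "(int N + 1, 0) \<notin> box f N"
      by (simp add: spine_box)
    show "vanishing \<eta>"
      by (simp add: vanishing_def \<eta>_def)
    fix u assume u: "u \<in> box f N"
    obtain x y where u_eq: "u = (x, y)" by (cases u)
    show "(\<Sum>w\<in>comb_nb f u. \<eta> u - \<eta> w) \<le> (if u = (p, 0) then 2 / real N else 0)"
    proof (cases "y = 0")
      case False
      have "(\<Sum>w\<in>comb_nb f u. \<eta> u - \<eta> w) = 0"
      proof (rule sum.neutral, rule ballI)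
        fix w assume "w \<in> comb_nb f u"
        then show "\<eta> u - \<eta> w = 0"
          unfolding u_eq using False by (cases w) (auto simp: comb_nb_iff intro: tooth)
      qed
      then show ?thesis using False u_eq by simp
    next
      case True
      have x: "\<bar>x\<bar> \<le> int N" using u u_eq by (simp add: box_def)
      have "(\<Sum>w\<in>comb_nb f u. \<eta> u - \<eta> w) = (\<Sum>w\<in>{(x - 1, 0), (x + 1, 0)}. \<eta> u - \<eta> w)"
      proof (rule sum.mono_neutral_right)
        show "{(x - 1, 0), (x + 1, 0)} \<subseteq> comb_nb f u"
          unfolding u_eq True by (auto simp: comb_nb_iff)
        show "\<forall>w\<in>comb_nb f u - {(x - 1, 0), (x + 1, 0)}. \<eta> u - \<eta> w = 0"
        proof
          fix w assume w: "w \<in> comb_nb f u - {(x - 1, 0), (x + 1, 0)}"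
          obtain x' y' where w_eq: "w = (x', y')" by (cases w)
          have "(x', y') \<in> comb_verts f \<and> x' = x"
            using w unfolding u_eq w_eq True by (auto simp: comb_nb_iff)
          then show "\<eta> u - \<eta> w = 0"
            unfolding u_eq w_eq True using tooth[of x 0 y'] by auto
        qed
      qed (simp add: finite_nb)
      also have "\<dots> = 2 * tent p x - tent p (x - 1) - tent p (x + 1)"
        using x \<eta>_spine[of x] \<eta>_spine[of "x - 1"] \<eta>_spine[of "x + 1"] u_eq True by simp
      also have "\<dots> \<le> (if x = p then 2 / real N else 0)"
      proof (cases "x = p")
        case True
        have "1 / real N \<le> 1" using N_ge_2 by simp
        then show ?thesis using True by (simp add: tent_def)
      next
        case False
        then show ?thesis using tent_convex[of x p] by simp
      qed
      finally show ?thesis using u_eq True by simp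
    qed
  qed
  then show ?thesis using N_ge_2 by (simp add: field_simps)
qed

text \<open>Along a tooth a subharmonic function is convex, and at the tip, whose only neighbour is the vertex below,
  it does not exceed the value at this neighbour. Convexity propagates the
  decrease from the tip down to the spine. The sign \<open>\<sigma>\<close> selects the upper or the lower tooth.\<close>
lemma heat_square_tooth_antimono:
  assumes x: "\<bar>x\<bar> \<le> int N" and \<sigma>: "\<sigma> = 1 \<or> \<sigma> = - 1"
  shows "heat_square (p, 0) T (x, \<sigma> * int (Suc j)) \<le> heat_square (p, 0) T (x, \<sigma> * int j)"
proof -
  define g where "g = (\<lambda>j::nat. heat_square (p, 0) T (x, \<sigma> * int j))"
  have V: "(x, \<sigma> * int j) \<in> comb_verts f \<longleftrightarrow> real j \<le> f x" for j
    using \<sigma> by (auto simp: comb_verts_iff)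
  have high: "g (Suc j) \<le> g j" if "nat \<lfloor>f x\<rfloor> \<le> j" for j
  proof -
    have "\<not> real (Suc j) \<le> f x" using that f_nonneg[of x] by (simp add: nat_le_iff floor_le_iff)
    then have "(x, \<sigma> * int (Suc j)) \<notin> box f N" using V[of "Suc j"] by (simp add: box_def)
    then show ?thesis
      using heat_square_outside heat_square_nonneg by (simp add: g_def)
  qed
  have "g (Suc j) \<le> g j" if "j \<le> nat \<lfloor>f x\<rfloor>" for j
    using that
  proof (induction rule: inc_induct)
    case base
    show ?case by (rule high) simp
  next
    case (step j)
    have V1: "(x, \<sigma> * int (Suc j)) \<in> comb_verts f"
      unfolding V using step.hyps(2) f_nonneg[of x] by linarith
    then have V0: "(x, \<sigma> * int j) \<in> comb_verts f"
      unfolding V by simp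
    let ?u = "(x, \<sigma> * int (Suc j))" and ?v = "(x, \<sigma> * int j)" and ?w = "(x, \<sigma> * int (Suc (Suc j)))"
    have nb: "comb_nb f ?u = (if ?w \<in> comb_verts f then {?v, ?w} else {?v})"
    proof (rule set_eqI)
      fix w :: "int \<times> int"
      obtain x' y' where w: "w = (x', y')" by (cases w)
      show "w \<in> comb_nb f ?u \<longleftrightarrow> w \<in> (if ?w \<in> comb_verts f then {?v, ?w} else {?v})"
      proof -
        have *: "\<bar>y' - \<sigma> * int (Suc j)\<bar> = 1 \<longleftrightarrow> y' = \<sigma> * int j \<or> y' = \<sigma> * int (Suc (Suc j))"
          using \<sigma> by auto
        show ?thesis unfolding w comb_nb_iff * using \<sigma> V0 V1 by auto
      qed
    qed
    have vw: "?v \<noteq> ?w" using \<sigma> by auto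
    have "deg ?u * g (Suc j) \<le> (\<Sum>w\<in>comb_nb f ?u. heat_square (p, 0) T w)"
      unfolding g_def
      by (rule heat_square_subharmonic) (use V1 x \<sigma> in \<open>auto simp: box_def\<close>)
    then have "if ?w \<in> comb_verts f then 2 * g (Suc j) \<le> g j + g (Suc (Suc j)) else g (Suc j) \<le> g j"
      unfolding deg_def nb using vw by (auto simp: g_def)
    then show ?case using step.IH by (auto split: if_splits)
  qed
  then show ?thesis
    using high[of j] by (cases "j \<le> nat \<lfloor>f x\<rfloor>") (auto simp: g_def)
qed

end

text \<open>Cut \<open>{..<K * m}\<close> into \<open>K\<close> blocks of length \<open>m\<close>; the first one has the largest sum.\<close>
lemma antimono_block_sum:
  fixes g :: "nat \<Rightarrow> real"
  assumes "\<And>j. g (Suc j) \<le> g j"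
  shows "(\<Sum>j<K * m. g j) \<le> real K * (\<Sum>j<m. g j)"
proof -
  have anti: "g j \<le> g i" if "i \<le> j" for i j
    by (rule lift_Suc_antimono_le[of g, OF assms that])
  have "(\<Sum>j<K * m. g j) = (\<Sum>q<K. \<Sum>j=q * m..<q * m + m. g j)"
    by (rule sum.nat_group[symmetric])
  also have "\<dots> \<le> (\<Sum>q<K. \<Sum>j<m. g j)"
  proof (rule sum_mono)
    fix q
    have "(\<Sum>j=q * m..<q * m + m. g j) = (\<Sum>j<m. g (j + q * m))"
      using sum.shift_bounds_nat_ivl[of g 0 "q * m" m] by (simp add: atLeast0LessThan add.commute)
    also have "\<dots> \<le> (\<Sum>j<m. g j)"
      by (intro sum_mono anti) simp
    finally show "(\<Sum>j=q * m..<q * m + m. g j) \<le> (\<Sum>j<m. g j)" .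
  qed
  finally show ?thesis by simp
qed

lemma sum_symmetric_interval:
  fixes h :: "int \<Rightarrow> real"
  assumes "\<And>y. 0 \<le> h y"
  shows "(\<Sum>y\<in>{- int L<..<int L}. h y) \<le> (\<Sum>j<L. h (int j)) + (\<Sum>j<L. h (- int j))"
    and "(\<Sum>j<L. h (int j)) + (\<Sum>j<L. h (- int j)) \<le> 2 * (\<Sum>y\<in>{- int L<..<int L}. h y)"
proof -
  let ?P = "int ` {..<L}" and ?M = "(\<lambda>j. - int j) ` {..<L}"
  have P: "(\<Sum>j<L. h (int j)) = sum h ?P" and M: "(\<Sum>j<L. h (- int j)) = sum h ?M"
    by (simp_all add: sum.reindex inj_on_def)
  have U: "{- int L<..<int L} = ?P \<union> ?M"
  proof
    show "{- int L<..<int L} \<subseteq> ?P \<union> ?M"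
    proof
      fix y assume "y \<in> {- int L<..<int L}"
      then show "y \<in> ?P \<union> ?M"
        by (cases "0 \<le> y") (auto simp: image_iff intro: bexI[of _ "nat y"] bexI[of _ "nat (- y)"])
    qed
  qed auto
  have "sum h (?P \<union> ?M) \<le> sum h ?P + sum h ?M"
    using sum.union_inter[of ?P ?M h] sum_nonneg[of "?P \<inter> ?M" h] assms by simp
  then show "(\<Sum>y\<in>{- int L<..<int L}. h y) \<le> (\<Sum>j<L. h (int j)) + (\<Sum>j<L. h (- int j))"
    by (simp only: P M U)
  have "sum h ?P \<le> sum h (?P \<union> ?M)" "sum h ?M \<le> sum h (?P \<union> ?M)"
    by (intro sum_mono2; simp add: assms)+
  then show "(\<Sum>j<L. h (int j)) + (\<Sum>j<L. h (- int j)) \<le> 2 * (\<Sum>y\<in>{- int L<..<int L}. h y)"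
    by (simp only: P M U)
qed

context comb_box
begin

text \<open>Only collisions in this set are counted. Farther out in the teeth the resistance to the boundary may be
  of order \<open>N log N\<close>, which would spoil \<open>overlap_low_le\<close>.\<close>
definition low :: "(int \<times> int) set" where
  "low = {u \<in> box f N. \<bar>snd u\<bar> < int N}"

lemma low_subset: "low \<subseteq> box f N"
  by (auto simp: low_def)

text \<open>Over the whole box the overlap at \<open>(p, 0)\<close> is at least \<open>N / 4\<close>. As the time-summed square of the heat kernel
  decreases along the teeth, the heights below \<open>N\<close> carry at least a share \<open>1 / K\<close> of each half
  tooth. A factor two is lost since both half teeth contain the spine vertex, and a factor four
  on the degrees.\<close>
lemma overlap_low_ge:
  assumes p: "p \<in> {0, 1}" and K: "\<And>x. \<bar>x\<bar> \<le> int N \<Longrightarrow> f x < real K * real N"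
  shows "\<exists>T. real N \<le> 32 * real K * overlap low T (p, 0) (p, 0)"
proof -
  obtain T where T: "real N / 4 \<le> (\<Sum>n<T. pairing (heat n (p, 0)) (heat n (p, 0)))"
    using norm_sum_ge[OF p] by blast
  define S where "S = heat_square (p, 0) T"
  have S0: "0 \<le> S u" for u
    by (simp add: S_def heat_square_nonneg)
  let ?I = "\<lambda>L::nat. {- int L<..<int L}"
  have "real N / 4 \<le> (\<Sum>n<T. pairing (heat n (p, 0)) (heat n (p, 0)))"
    by (rule T)
  also have "\<dots> = (\<Sum>u\<in>box f N. deg u * S u)"
    unfolding pairing_def S_def heat_square_def
    by (subst sum.swap) (simp add: sum_distrib_left power2_eq_square)
  also have "\<dots> \<le> (\<Sum>u\<in>box f N. 4 * S u)"
    by (intro sum_mono mult_right_mono deg_le S0)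
  also have "\<dots> = 4 * (\<Sum>u\<in>box f N. S u)"
    by (simp add: sum_distrib_left)
  also have "(\<Sum>u\<in>box f N. S u) \<le> (\<Sum>u\<in>{- int N..int N} \<times> ?I (K * N). S u)"
  proof (rule sum_mono2)
    show "box f N \<subseteq> {- int N..int N} \<times> ?I (K * N)"
    proof
      fix u assume u: "u \<in> box f N"
      obtain x y where u_eq: "u = (x, y)" by (cases u)
      have x: "\<bar>x\<bar> \<le> int N" "\<bar>of_int y\<bar> \<le> f x" using u u_eq by (auto simp: box_def comb_verts_iff)
      then have "\<bar>of_int y\<bar> < real (K * N)" using K[of x] by simp
      then have "\<bar>y\<bar> < int (K * N)" by linarith
      then show "u \<in> {- int N..int N} \<times> ?I (K * N)" using x(1) u_eq by auto
    qed
  qed (simp_all add: S0)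
  also have "\<dots> = (\<Sum>x=- int N..int N. \<Sum>y\<in>?I (K * N). S (x, y))"
    by (simp add: sum.cartesian_product)
  also have "\<dots> \<le> (\<Sum>x=- int N..int N. 2 * real K * (\<Sum>y\<in>?I N. S (x, y)))"
  proof (rule sum_mono)
    fix x assume "x \<in> {- int N..int N}"
    then have x: "\<bar>x\<bar> \<le> int N" by auto
    have up: "(\<Sum>j<K * N. S (x, int j)) \<le> real K * (\<Sum>j<N. S (x, int j))"
      by (rule antimono_block_sum)
        (use heat_square_tooth_antimono[OF x, of 1] in \<open>simp add: S_def\<close>)
    have down: "(\<Sum>j<K * N. S (x, - int j)) \<le> real K * (\<Sum>j<N. S (x, - int j))"
      by (rule antimono_block_sum)
        (use heat_square_tooth_antimono[OF x, of "- 1"] in \<open>simp add: S_def\<close>)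
    have "(\<Sum>y\<in>?I (K * N). S (x, y)) \<le> (\<Sum>j<K * N. S (x, int j)) + (\<Sum>j<K * N. S (x, - int j))"
      by (rule sum_symmetric_interval) (rule S0)
    also have "\<dots> \<le> real K * ((\<Sum>j<N. S (x, int j)) + (\<Sum>j<N. S (x, - int j)))"
      using up down by (simp add: distrib_left)
    also have "\<dots> \<le> real K * (2 * (\<Sum>y\<in>?I N. S (x, y)))"
      by (intro mult_left_mono sum_symmetric_interval(2) S0) simp
    finally show "(\<Sum>y\<in>?I (K * N). S (x, y)) \<le> 2 * real K * (\<Sum>y\<in>?I N. S (x, y))" by simp
  qed
  also have "\<dots> = 2 * real K * (\<Sum>u\<in>{- int N..int N} \<times> ?I N. S u)"
    by (simp add: sum.cartesian_product sum_distrib_left)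
  also have "(\<Sum>u\<in>{- int N..int N} \<times> ?I N. S u) = (\<Sum>u\<in>low. S u)"
  proof (rule sum.mono_neutral_right)
    show "\<forall>u\<in>{- int N..int N} \<times> ?I N - low. S u = 0"
    proof
      fix u assume "u \<in> {- int N..int N} \<times> ?I N - low"
      then have "u \<notin> box f N" by (auto simp: low_def)
      then show "S u = 0" by (simp add: S_def heat_square_outside)
    qed
  qed (auto simp: low_def box_def)
  also have "\<dots> \<le> (\<Sum>u\<in>low. deg u * S u)"
  proof (rule sum_mono)
    fix u assume "u \<in> low"
    then have "1 \<le> deg u" using deg_ge_1 low_subset by blast
    then show "S u \<le> deg u * S u" using mult_right_mono[OF _ S0[of u], of 1 "deg u"] by simp
  qed
  also have "\<dots> = overlap low T (p, 0) (p, 0)"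
    unfolding overlap_def S_def heat_square_def
    by (subst sum.swap) (simp add: sum_distrib_left power2_eq_square)
  finally have "real N / 4 \<le> 4 * (2 * real K * overlap low T (p, 0) (p, 0))"
    by (simp add: mult_left_mono)
  then show ?thesis by (intro exI[of _ T]) simp
qed

text \<open>In the small box of radius \<open>n\<close> all resistances to the middle of the spine are of order \<open>K * n\<close>, whereas
  the overlap in the middle is at least \<open>N / (32 * K)\<close>. The constant 7680 is chosen such that
  the former are negligible, so that the overlap of \<open>x\<close> and \<open>y\<close> is at least \<open>N / (64 * K)\<close>; it is to
  be compared with the maximal overlap \<open>16 * N\<close>.\<close>
lemma avoidance_contraction:
  assumes K: "1 \<le> K" "\<And>x. \<bar>x\<bar> \<le> int N \<Longrightarrow> f x < real K * real N"
    and n: "1 \<le> n" "\<And>x. \<bar>x\<bar> \<le> int n \<Longrightarrow> f x \<le> real K * real n"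
    and N: "7680 * K\<^sup>2 * n \<le> N"
    and s_le: "\<And>x y. x \<in> box f (Suc N) \<Longrightarrow> y \<in> box f (Suc N) \<Longrightarrow> par x = par y \<Longrightarrow> s x y \<le> \<sigma>"
    and s_diag: "\<And>x. s x x = 0"
    and s_step: "\<And>x y. x \<in> comb_verts f \<Longrightarrow> y \<in> comb_verts f \<Longrightarrow> x \<noteq> y \<Longrightarrow>
        s x y \<le> (\<Sum>w\<in>comb_nb f x. \<Sum>z\<in>comb_nb f y. s w z)
          / (real (card (comb_nb f x)) * real (card (comb_nb f y)))"
    and \<sigma>: "0 \<le> \<sigma>"
    and xy: "x \<in> box f n" "y \<in> box f n" "par x = par y"
  shows "s x y \<le> \<sigma> * (1 - 1 / (1024 * real K))"
proof -
  have Kn: "real K * real n * (7680 * real K) \<le> real N"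
  proof -
    have "real (7680 * K\<^sup>2 * n) \<le> real N"
      using N by (simp only: of_nat_le_iff)
    then show ?thesis by (simp add: power2_eq_square mult_ac)
  qed
  have K1: "1 \<le> real K" and n1: "1 \<le> real n" and N0: "0 < real N"
    using K(1) n(1) N_ge_2 by auto
  have "n \<le> N"
  proof -
    have "1 * n \<le> (7680 * K\<^sup>2) * n" using K(1) by (intro mult_le_mono1) simp
    also have "\<dots> \<le> N" by (rule N)
    finally show ?thesis by simp
  qed
  then have xyB: "x \<in> box f N" "y \<in> box f N"
    using xy by (auto simp: box_def)
  \<comment> \<open>The spine vertices \<open>(0, 0)\<close> and \<open>(1, 0)\<close> represent the two parity classes.\<close>
  obtain p :: int where p: "p \<in> {0, 1}" and par: "par (p, 0) = par x"
    by (cases "par x") (auto simp: par_def)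
  obtain T where T: "real N \<le> 32 * real K * overlap low T (p, 0) (p, 0)"
    using overlap_low_ge[OF p K(2)] by blast
  have res: "resistance_le u (p, 0) (6 * (real K * real n))" if u: "u \<in> box f n" for u
  proof -
    obtain a b where ab: "u = (a, b)" by (cases u)
    have uB: "(a, b) \<in> box f N" using u ab \<open>n \<le> N\<close> by (auto simp: box_def)
    have "\<bar>of_int b\<bar> \<le> f a" "\<bar>a\<bar> \<le> int n" using u ab by (auto simp: box_def comb_verts_iff)
    then have b: "\<bar>of_int b\<bar> \<le> real K * real n" using n(2)[of a] by linarith
    have a: "\<bar>of_int (a - p)\<bar> \<le> 2 * real n"
      using \<open>\<bar>a\<bar> \<le> int n\<close> p n1 by auto
    have "2 * real n \<le> 2 * (real K * real n)" using K1 n1 by simp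
    then have "2 * (\<bar>of_int b\<bar> + \<bar>of_int (a - p)\<bar>) \<le> 6 * (real K * real n)" using a b by argo
    then show ?thesis
      using resistance_to_spine[OF uB, of p] p N_ge_2 unfolding ab by (auto intro: resistance_le_mono)
  qed
  have "3 / 4 * overlap low T (p, 0) (p, 0) - 5 * (6 * (real K * real n) + 6 * (real K * real n))
      \<le> overlap low T x y"
    by (rule overlap_comparison[OF low_subset res[OF xy(1)] _ res[OF xy(2)]]) (use xy par in auto)
  moreover have "60 * (real K * real n) \<le> real N / (128 * real K)"
    using Kn K1 by (simp add: field_simps)
  moreover have "real N / (32 * real K) \<le> overlap low T (p, 0) (p, 0)"
    using T K1 by (simp add: field_simps)
  moreover have "real N / (32 * real K) = 4 * (real N / (128 * real K))"
    "real N / (64 * real K) = 2 * (real N / (128 * real K))"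
    by simp_all
  ultimately have ov: "real N / (64 * real K) \<le> overlap low T x y"
    by argo
  have "s x y \<le> \<sigma> * (1 - overlap low T x y / (16 * real N))"
  proof (rule avoidance_le_overlap[OF low_subset, where C = "box f (Suc N)"])
    show "overlap low T a a \<le> 16 * real N" if "a \<in> low" for T a
      using that by (intro overlap_low_le low_subset) (auto simp: low_def)
    show "w \<in> box f (Suc N)" if "u \<in> box f N" "w \<in> comb_nb f u" for u w
      using that by (cases u; cases w) (auto simp: box_def comb_nb_iff)
  qed (use N0 s_le s_diag s_step \<sigma> xy xyB in \<open>auto simp: box_def deg_def\<close>)
  also have "\<dots> \<le> \<sigma> * (1 - 1 / (1024 * real K))"
  proof (intro mult_left_mono \<sigma> diff_left_mono)
    have "1 / (1024 * real K) = real N / (64 * real K) / (16 * real N)"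
      using N0 K1 by (simp add: field_simps)
    also have "\<dots> \<le> overlap low T x y / (16 * real N)"
      using ov N0 by (intro divide_right_mono) auto
    finally show "1 / (1024 * real K) \<le> overlap low T x y / (16 * real N)" .
  qed
  finally show ?thesis .
qed

end

section \<open>Never meeting has probability zero\<close>
lemma growth_bound:
  fixes f :: "int \<Rightarrow> real"
  assumes f: "\<And>x. 0 \<le> f x"
    and O: "(\<lambda>n::nat. f (- int n) + f (int n)) \<in> O(\<lambda>n. real n * ln (real n))"
  obtains C where "0 < C"
    and "\<And>n x. 2 \<le> n \<Longrightarrow> \<bar>x\<bar> \<le> int n \<Longrightarrow> f x \<le> C * (real n * ln (real n))"
proof -
  obtain c where c: "0 < c"
    and ev: "\<forall>\<^sub>F n in sequentially. norm (f (- int n) + f (int n)) \<le> c * norm (real n * ln (real n))"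
    using O by (elim landau_o.bigE) blast
  then obtain m where m: "\<And>n. n \<ge> m \<Longrightarrow> \<bar>f (- int n) + f (int n)\<bar> \<le> c * \<bar>real n * ln (real n)\<bar>"
    by (auto simp: eventually_sequentially)
  define D where "D = (\<Sum>x=- int m..int m. f x)"
  have D: "0 \<le> D" unfolding D_def by (intro sum_nonneg f)
  show ?thesis
  proof (rule that[of "c + D"])
    show "0 < c + D" using c D by simp
    fix n :: nat and x :: int assume n: "2 \<le> n" and x: "\<bar>x\<bar> \<le> int n"
    have "1 \<le> 2 * ln (2::real)" using ln2_ge_two_thirds by simp
    also have "\<dots> \<le> real n * ln (real n)" using n by (intro mult_mono) auto
    finally have n1: "1 \<le> real n * ln (real n)" .
    show "f x \<le> (c + D) * (real n * ln (real n))"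
    proof (cases "\<bar>x\<bar> \<le> int m")
      case True
      then have "f x \<le> D" unfolding D_def by (intro member_le_sum f) auto
      also have "\<dots> \<le> D * (real n * ln (real n))" using mult_left_mono[OF n1 D] by simp
      also have "\<dots> \<le> (c + D) * (real n * ln (real n))" using c n1 by (intro mult_right_mono) auto
      finally show ?thesis .
    next
      case False
      define k where "k = nat \<bar>x\<bar>"
      have k: "m \<le> k" "1 \<le> k" "k \<le> n" using False x by (auto simp: k_def)
      have "f x \<le> f (- int k) + f (int k)"
        using f[of "int k"] f[of "- int k"] by (cases "0 \<le> x") (auto simp: k_def)
      also have "\<dots> \<le> c * \<bar>real k * ln (real k)\<bar>" using m[OF k(1)] by simp
      also have "\<dots> = c * (real k * ln (real k))" using k by simp
      also have "\<dots> \<le> c * (real n * ln (real n))" using k c by (intro mult_left_mono mult_mono) auto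
      also have "\<dots> \<le> (c + D) * (real n * ln (real n))" using D n1 by (intro mult_right_mono) auto
      finally show ?thesis .
    qed
  qed
qed

lemma ln_fact_le: "1 \<le> n \<Longrightarrow> ln (fact n :: real) \<le> real n * ln (real n)"
proof -
  assume n: "1 \<le> n"
  have "(fact n :: real) \<le> real n ^ n"
    using fact_le_power[of n] by simp
  then have "ln (fact n :: real) \<le> ln (real n ^ n)"
    using n by (subst ln_le_cancel_iff) auto
  then show ?thesis using n by (simp add: ln_realpow)
qed

text \<open>Summed over \<open>n\<close> this yields the divergence of the series of \<open>1 / (n log n)\<close>.\<close>
lemma ln_ln_increment_le:
  assumes "2 \<le> n"
  shows "ln (ln (real (Suc n))) - ln (ln (real n)) \<le> 1 / (real n * ln (real n))"
proof -
  have l: "0 < ln (real n)" using assms by simp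
  have "ln (ln (real (Suc n))) - ln (ln (real n)) = ln (ln (real (Suc n)) / ln (real n))"
    using assms l by (simp add: ln_div)
  also have "\<dots> \<le> ln (real (Suc n)) / ln (real n) - 1"
    using assms l by (intro ln_le_minus_one) simp
  also have "\<dots> = (ln (real (Suc n)) - ln (real n)) / ln (real n)"
    using l by (simp add: field_simps)
  also have "ln (real (Suc n)) - ln (real n) = ln (real (Suc n) / real n)"
    using assms by (simp add: ln_div)
  also have "\<dots> \<le> real (Suc n) / real n - 1"
    using assms by (intro ln_le_minus_one) simp
  also have "\<dots> = 1 / real n" using assms by (simp add: field_simps)
  finally show ?thesis using l by (simp add: divide_right_mono)
qed

text \<open>The radii \<open>R j = (fact j) ^ 4\<close> have ratio \<open>(j + 1) ^ 4\<close>, which eventually exceeds any multiple of the square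
  of \<open>K j\<close>, the latter being of order \<open>log (R (j + 1))\<close>, that is \<open>j log j\<close>. So \<open>avoidance_contraction\<close>
  applies to consecutive radii. Starting from the trivial bound \<open>1\<close> on a very large box and descending
  to a fixed one bounds \<open>s\<close> by a tail of a product that diverges to zero.\<close>
theorem avoidance_zero:
  fixes f :: "int \<Rightarrow> real" and s :: "int \<times> int \<Rightarrow> int \<times> int \<Rightarrow> real"
  assumes f: "\<And>x. 0 \<le> f x"
    and O: "(\<lambda>n::nat. f (- int n) + f (int n)) \<in> O(\<lambda>n. real n * ln (real n))"
    and s_nonneg: "\<And>x y. 0 \<le> s x y" and s_le_1: "\<And>x y. s x y \<le> 1"
    and s_diag: "\<And>x. s x x = 0"
    and s_step: "\<And>x y. x \<in> comb_verts f \<Longrightarrow> y \<in> comb_verts f \<Longrightarrow> x \<noteq> y \<Longrightarrow>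
        s x y \<le> (\<Sum>w\<in>comb_nb f x. \<Sum>z\<in>comb_nb f y. s w z)
          / (real (card (comb_nb f x)) * real (card (comb_nb f y)))"
    and xy: "x \<in> comb_verts f" "y \<in> comb_verts f" "par x = par y"
  shows "s x y = 0"
proof -
  obtain C where C: "0 < C"
    and fC: "\<And>n x. 2 \<le> n \<Longrightarrow> \<bar>x\<bar> \<le> int n \<Longrightarrow> f x \<le> C * (real n * ln (real n))"
    using growth_bound[OF f O] by metis
  define R :: "nat \<Rightarrow> nat" where "R j = fact j ^ 4" for j
  \<comment> \<open>A natural number above \<open>C * ln (R (Suc j))\<close>, because \<open>ln (fact n) \<le> n * ln n\<close>.\<close>
  define K where "K j = nat \<lfloor>4 * C * (real (Suc j) * ln (real (Suc j)))\<rfloor> + 1" for j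
  define D where "D = 4 * C + 1"
  have D: "0 < D" using C by (simp add: D_def)
  have K_gt: "4 * C * (real (Suc j) * ln (real (Suc j))) < real (K j)" for j
    unfolding K_def by linarith
  have K_le: "real (K j) \<le> D * (real (Suc j) * ln (real (Suc j)))" if "1 \<le> j" for j
  proof -
    have "1 \<le> 2 * ln (2::real)" using ln2_ge_two_thirds by simp
    also have "\<dots> \<le> real (Suc j) * ln (real (Suc j))" using that by (intro mult_mono) auto
    finally have 1: "1 \<le> real (Suc j) * ln (real (Suc j))" .
    have "0 \<le> 4 * C * (real (Suc j) * ln (real (Suc j)))" using C 1 by simp
    then have "real (K j) \<le> 4 * C * (real (Suc j) * ln (real (Suc j))) + 1"
      unfolding K_def by linarith
    then show ?thesis using 1 by (simp add: D_def algebra_simps)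
  qed
  have "eventually (\<lambda>j::nat. 15360 * (D * (real (Suc j) * ln (real (Suc j))))\<^sup>2 \<le> real (Suc j) ^ 4) sequentially"
    using D by real_asymp
  then obtain j\<^sub>0 where j0: "\<And>j. j \<ge> j\<^sub>0 \<Longrightarrow> 15360 * (D * (real (Suc j) * ln (real (Suc j))))\<^sup>2 \<le> real (Suc j) ^ 4"
    by (auto simp: eventually_sequentially)
  define a where "a j = 1 / (1024 * real (K j))" for j
  have K1: "1 \<le> K j" for j by (simp add: K_def)
  have a01: "0 \<le> a j" "a j \<le> 1" for j
    using K1[of j] by (auto simp: a_def divide_le_eq)
  have contraction: "s u w \<le> \<sigma> * (1 - a j)"
    if j: "j\<^sub>0 \<le> j" "2 \<le> j" and \<sigma>: "0 \<le> \<sigma>"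
      and IH: "\<And>u w. u \<in> box f (Suc (R (Suc j))) \<Longrightarrow> w \<in> box f (Suc (R (Suc j))) \<Longrightarrow> par u = par w \<Longrightarrow> s u w \<le> \<sigma>"
      and uw: "u \<in> box f (Suc (R j))" "w \<in> box f (Suc (R j))" "par u = par w"
    for j \<sigma> u w
  proof -
    have R1: "1 \<le> R j" by (simp add: R_def)
    have R_Suc: "R (Suc j) = (Suc j) ^ 4 * R j"
      unfolding R_def fact_Suc by (simp only: power_mult_distrib of_nat_id)
    have "3 ^ 4 * 1 \<le> (Suc j) ^ 4 * R j" using j R1 by (intro mult_le_mono power_mono) auto
    then have R81: "81 \<le> R (Suc j)" by (simp add: R_Suc)
    have "2 * R j \<le> (Suc j) ^ 4 * R j"
      using j by (intro mult_le_mono1 order_trans[OF _ self_le_power]) auto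
    then have Rle: "Suc (R j) \<le> R (Suc j)" using R1 unfolding R_Suc by linarith
    interpret comb_box f "R (Suc j)"
      using f R81 by unfold_locales auto
    have lnR: "C * ln (real (R (Suc j))) < real (K j)"
    proof -
      have "ln (real (R (Suc j))) = 4 * ln (fact (Suc j))"
        unfolding R_def of_nat_power of_nat_fact by (rule ln_realpow[of _ 4, simplified])
      also have "\<dots> \<le> 4 * (real (Suc j) * ln (real (Suc j)))"
        using ln_fact_le[of "Suc j"] by simp
      finally have "C * ln (real (R (Suc j))) \<le> C * (4 * (real (Suc j) * ln (real (Suc j))))"
        using C by (intro mult_left_mono) auto
      then show ?thesis using K_gt[of j] by linarith
    qed
    show ?thesis
      unfolding a_def
    proof (rule avoidance_contraction[where n = "Suc (R j)", OF K1 _ _ _ _ IH s_diag s_step \<sigma> uw])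
      show "f x < real (K j) * real (R (Suc j))" if "\<bar>x\<bar> \<le> int (R (Suc j))" for x
      proof -
        have "f x \<le> C * (real (R (Suc j)) * ln (real (R (Suc j))))"
          using R81 that by (intro fC) auto
        also have "\<dots> = C * ln (real (R (Suc j))) * real (R (Suc j))" by simp
        also have "\<dots> < real (K j) * real (R (Suc j))"
          using lnR R81 by (intro mult_strict_right_mono) auto
        finally show ?thesis .
      qed
      show "f x \<le> real (K j) * real (Suc (R j))" if "\<bar>x\<bar> \<le> int (Suc (R j))" for x
      proof -
        have "f x \<le> C * (real (Suc (R j)) * ln (real (Suc (R j))))"
          using R1 that by (intro fC) auto
        also have "\<dots> = C * ln (real (Suc (R j))) * real (Suc (R j))" by simp
        also have "\<dots> \<le> C * ln (real (R (Suc j))) * real (Suc (R j))"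
          using Rle C by (intro mult_right_mono mult_left_mono) auto
        also have "\<dots> \<le> real (K j) * real (Suc (R j))"
          using lnR by (intro mult_right_mono) auto
        finally show ?thesis .
      qed
      have "real (7680 * (K j)\<^sup>2 * Suc (R j)) \<le> 7680 * (real (K j))\<^sup>2 * (2 * real (R j))"
        using R1 unfolding of_nat_mult of_nat_power of_nat_numeral by (intro mult_left_mono) auto
      also have "\<dots> = 15360 * (real (K j))\<^sup>2 * real (R j)" by simp
      also have "\<dots> \<le> 15360 * (D * (real (Suc j) * ln (real (Suc j))))\<^sup>2 * real (R j)"
        using K_le[of j] j by (intro mult_right_mono mult_left_mono power_mono) auto
      also have "\<dots> \<le> real (Suc j) ^ 4 * real (R j)"
        by (intro mult_right_mono j0 j) simp
      also have "\<dots> = real (R (Suc j))" by (simp add: R_Suc)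
      finally show "7680 * (K j)\<^sup>2 * Suc (R j) \<le> R (Suc j)" by (simp only: of_nat_le_iff)
    qed simp_all
  qed
  have product: "s u w \<le> (\<Prod>i=j..<j + d. 1 - a i)"
    if "j\<^sub>0 \<le> j" "2 \<le> j" "u \<in> box f (Suc (R j))" "w \<in> box f (Suc (R j))" "par u = par w" for j d u w
    using that
  proof (induction d arbitrary: j u w)
    case (Suc d)
    have "s u w \<le> (\<Prod>i=Suc j..<Suc j + d. 1 - a i) * (1 - a j)"
    proof (rule contraction[OF Suc.prems(1,2)])
      show "0 \<le> (\<Prod>i=Suc j..<Suc j + d. 1 - a i)" using a01 by (intro prod_nonneg) auto
      show "s u' w' \<le> (\<Prod>i=Suc j..<Suc j + d. 1 - a i)"
        if "u' \<in> box f (Suc (R (Suc j)))" "w' \<in> box f (Suc (R (Suc j)))" "par u' = par w'" for u' w'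
        by (rule Suc.IH) (use Suc.prems(1,2) that in auto)
    qed (use Suc.prems in auto)
    also have "\<dots> = (\<Prod>i=j..<j + Suc d. 1 - a i)"
      by (simp add: prod.atLeast_Suc_lessThan mult.commute)
    finally show ?case .
  qed (use s_le_1 in simp)
  define j where "j = max (max j\<^sub>0 2) (nat \<bar>fst x\<bar> + nat \<bar>fst y\<bar>)"
  have j: "j\<^sub>0 \<le> j" "2 \<le> j" by (auto simp: j_def)
  have "j \<le> fact j" by (rule fact_ge_self)
  also have "\<dots> \<le> R j" unfolding R_def by (rule self_le_power) auto
  finally have jR: "int j \<le> int (R j)" by simp
  have "nat \<bar>fst x\<bar> \<le> j" "nat \<bar>fst y\<bar> \<le> j"
    by (simp_all add: j_def le_max_iff_disj)
  then have xyR: "x \<in> box f (Suc (R j))" "y \<in> box f (Suc (R j))"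
    using xy jR by (auto simp: box_def)
  let ?L = "\<lambda>i::nat. ln (ln (real i))"
  define c where "c = 1 / (1024 * D)"
  have c: "0 < c" using D by (simp add: c_def)
  have bound: "s x y \<le> exp (c * ?L (Suc j)) * exp (- c * ?L (Suc (j + d)))" for d
  proof -
    have "s x y \<le> (\<Prod>i=j..<j + d. 1 - a i)"
      by (rule product[OF j xyR xy(3)])
    also have "\<dots> \<le> (\<Prod>i=j..<j + d. exp (- a i))"
      using a01 exp_ge_add_one_self[of "- a _"] by (intro prod_mono) auto
    also have "\<dots> = exp (- (\<Sum>i=j..<j + d. a i))"
      by (simp add: exp_sum sum_negf[symmetric])
    also have "\<dots> \<le> exp (- (c * (?L (Suc (j + d)) - ?L (Suc j))))"
    proof -
      have "c * (?L (Suc (j + d)) - ?L (Suc j)) = (\<Sum>i=j..<j + d. c * (?L (Suc (Suc i)) - ?L (Suc i)))"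
        by (subst sum_distrib_left[symmetric], subst sum_Suc_diff') auto
      also have "\<dots> \<le> (\<Sum>i=j..<j + d. a i)"
      proof (rule sum_mono)
        fix i assume "i \<in> {j..<j + d}"
        then have i: "2 \<le> i" using j by auto
        have "c * (?L (Suc (Suc i)) - ?L (Suc i)) \<le> c * (1 / (real (Suc i) * ln (real (Suc i))))"
          using c i by (intro mult_left_mono ln_ln_increment_le) auto
        also have "\<dots> = 1 / (1024 * (D * (real (Suc i) * ln (real (Suc i)))))"
          by (simp add: c_def)
        also have "\<dots> \<le> a i"
          unfolding a_def using K_le[of i] K1[of i] i by (intro divide_left_mono mult_left_mono) (auto simp: D)
        finally show "c * (?L (Suc (Suc i)) - ?L (Suc i)) \<le> a i" .
      qed
      finally show ?thesis by simp
    qed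
    also have "\<dots> = exp (c * ?L (Suc j)) * exp (- c * ?L (Suc (j + d)))"
      by (simp add: exp_add[symmetric] algebra_simps)
    finally show ?thesis .
  qed
  have "(\<lambda>d. exp (- c * ?L (Suc (j + d)))) \<longlonglongrightarrow> 0"
    using c by real_asymp
  then have "(\<lambda>d. exp (c * ?L (Suc j)) * exp (- c * ?L (Suc (j + d)))) \<longlonglongrightarrow> exp (c * ?L (Suc j)) * 0"
    by (intro tendsto_intros)
  then have "s x y \<le> exp (c * ?L (Suc j)) * 0"
    by (rule LIMSEQ_le_const) (use bound in blast)
  then show ?thesis using s_nonneg[of x y] by simp
qed

section \<open>Two independent walks on a probability space\<close>

text \<open>First-step recursion for the probability that independent walks from \<open>x\<close> and \<open>y\<close> do not meet at any
  of the times \<open>0, \<dots>, T\<close>.\<close>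
fun avoid :: "('a \<Rightarrow> 'a set) \<Rightarrow> nat \<Rightarrow> 'a \<Rightarrow> 'a \<Rightarrow> real" where
  "avoid nb 0 x y = (if x = y then 0 else 1)"
| "avoid nb (Suc T) x y = (if x = y then 0 else
     (\<Sum>w\<in>nb x. \<Sum>z\<in>nb y. avoid nb T w z) / (real (card (nb x)) * real (card (nb y))))"

lemma avoid_nonneg: "0 \<le> avoid nb T x y"
  by (induction T arbitrary: x y) (auto intro!: divide_nonneg_nonneg sum_nonneg)

lemma avoid_le_1: "avoid nb T x y \<le> 1"
proof (induction T arbitrary: x y)
  case (Suc T)
  have "(\<Sum>w\<in>nb x. \<Sum>z\<in>nb y. avoid nb T w z) \<le> (\<Sum>w\<in>nb x. \<Sum>z\<in>nb y. 1)"
    by (intro sum_mono Suc.IH)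
  then have "(\<Sum>w\<in>nb x. \<Sum>z\<in>nb y. avoid nb T w z) \<le> real (card (nb x)) * real (card (nb y))"
    by simp
  then show ?case by (auto simp: divide_le_eq_1 zero_less_mult_iff not_less)
qed simp

lemma avoid_same: "avoid nb T x x = 0"
  by (cases T) auto

lemma avoid_Suc_le: "avoid nb (Suc T) x y \<le> avoid nb T x y"
proof (induction T arbitrary: x y)
  case 0
  show ?case using avoid_le_1[of nb "Suc 0" x y] avoid_same[of nb "Suc 0" x] by (cases "x = y") auto
next
  case (Suc T)
  have "(\<Sum>w\<in>nb x. \<Sum>z\<in>nb y. avoid nb (Suc T) w z) \<le> (\<Sum>w\<in>nb x. \<Sum>z\<in>nb y. avoid nb T w z)"
    by (intro sum_mono Suc.IH)
  then show ?case
    unfolding avoid.simps(2)[of nb "Suc T"] avoid.simps(2)[of nb T x]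
    by (auto intro!: divide_right_mono simp del: avoid.simps)
qed

lemma avoid_tendsto:
  obtains s where "\<And>x y. (\<lambda>T. avoid nb T x y) \<longlonglongrightarrow> s x y"
    and "\<And>x y. 0 \<le> s x y" "\<And>x y. s x y \<le> 1" "\<And>x. s x x = 0"
    and "\<And>x y. x \<noteq> y \<Longrightarrow> s x y
      = (\<Sum>w\<in>nb x. \<Sum>z\<in>nb y. s w z) / (real (card (nb x)) * real (card (nb y)))"
proof -
  have "convergent (\<lambda>T. avoid nb T x y)" for x y
  proof (rule Bseq_monoseq_convergent)
    show "Bseq (\<lambda>T. avoid nb T x y)"
      by (rule BseqI'[of _ 1]) (simp add: avoid_nonneg avoid_le_1)
    show "monoseq (\<lambda>T. avoid nb T x y)"
      by (rule decseq_imp_monoseq) (intro decseq_SucI avoid_Suc_le)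
  qed
  then have lim: "(\<lambda>T. avoid nb T x y) \<longlonglongrightarrow> lim (\<lambda>T. avoid nb T x y)" for x y
    by (simp add: convergent_LIMSEQ_iff)
  define s where "s x y = lim (\<lambda>T. avoid nb T x y)" for x y
  have s: "(\<lambda>T. avoid nb T x y) \<longlonglongrightarrow> s x y" for x y
    unfolding s_def by (rule lim)
  show ?thesis
  proof (rule that)
    show "(\<lambda>T. avoid nb T x y) \<longlonglongrightarrow> s x y" for x y by (rule s)
    show "0 \<le> s x y" for x y
      by (rule LIMSEQ_le_const[OF s]) (simp add: avoid_nonneg)
    show "s x y \<le> 1" for x y
      by (rule LIMSEQ_le_const2[OF s]) (simp add: avoid_le_1)
    show "s x x = 0" for x
      using LIMSEQ_unique[OF s[of x x]] by (simp add: avoid_same)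
    show "s x y = (\<Sum>w\<in>nb x. \<Sum>z\<in>nb y. s w z) / (real (card (nb x)) * real (card (nb y)))"
      if "x \<noteq> y" for x y
    proof (rule LIMSEQ_unique)
      show "(\<lambda>T. avoid nb (Suc T) x y) \<longlonglongrightarrow> s x y"
        by (rule LIMSEQ_Suc[OF s])
      have "(\<lambda>T. (\<Sum>w\<in>nb x. \<Sum>z\<in>nb y. avoid nb T w z) * inverse (real (card (nb x)) * real (card (nb y))))
          \<longlonglongrightarrow> (\<Sum>w\<in>nb x. \<Sum>z\<in>nb y. s w z) * inverse (real (card (nb x)) * real (card (nb y)))"
        by (intro tendsto_intros s)
      then show "(\<lambda>T. avoid nb (Suc T) x y)
          \<longlonglongrightarrow> (\<Sum>w\<in>nb x. \<Sum>z\<in>nb y. s w z) / (real (card (nb x)) * real (card (nb y)))"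
        using that by (simp add: divide_inverse)
    qed
  qed
qed

locale walk_graph = prob_space M for M :: "'w measure" +
  fixes V :: "'a :: countable set" and E :: "'a set set" and v :: 'a
  assumes finite_neighbours: "finite (neighbours V E u)"
    and neighbours_nonempty: "u \<in> V \<Longrightarrow> neighbours V E u \<noteq> {}"
begin

abbreviation nb :: "'a \<Rightarrow> 'a set" where
  "nb \<equiv> neighbours V E"

lemma walk_measurable: "simple_random_walk M V E v X \<Longrightarrow> X n \<in> measurable M (count_space UNIV)"
  by (simp add: simple_random_walk_def)

lemma path_prob_0:
  assumes X: "simple_random_walk M V E v X" and pos: "0 < prob {\<omega> \<in> space M. X 0 \<omega> = u}"
  shows "u = v"
proof (rule ccontr)
  assume "u \<noteq> v"
  then have "AE \<omega> in M. \<not> X 0 \<omega> = u"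
    using X by (auto simp: simple_random_walk_def elim: eventually_mono)
  then have "prob {\<omega> \<in> space M. X 0 \<omega> = u} = 0"
    using walk_measurable[OF X] by (subst prob_eq_0) auto
  with pos show False by simp
qed

text \<open>The transition law is given only through histories of positive probability; for the others both sides
  vanish.\<close>
lemma path_prob_Suc:
  assumes X: "simple_random_walk M V E v X"
  shows "prob {\<omega> \<in> space M. \<forall>i\<le>Suc n. X i \<omega> = x i}
    = prob {\<omega> \<in> space M. \<forall>i\<le>n. X i \<omega> = x i} * pmf (pmf_of_set (nb (x n))) (x (Suc n))"
proof -
  note [measurable] = walk_measurable[OF X]
  let ?H = "{\<omega> \<in> space M. \<forall>i\<le>n. X i \<omega> = x i}"
  have eq: "{\<omega> \<in> space M. \<forall>i\<le>Suc n. X i \<omega> = x i}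
      = {\<omega> \<in> space M. X (Suc n) \<omega> = x (Suc n) \<and> (\<forall>i\<le>n. X i \<omega> = x i)}"
    by (auto simp: le_Suc_eq)
  show ?thesis
  proof (cases "0 < prob ?H")
    case True
    with X have "\<P>(\<omega> in M. X (Suc n) \<omega> = x (Suc n) \<bar> \<forall>i\<le>n. X i \<omega> = x i)
        = pmf (pmf_of_set (nb (x n))) (x (Suc n))"
      unfolding simple_random_walk_def by blast
    with True show ?thesis
      unfolding eq by (simp add: cond_prob_def field_simps)
  next
    case False
    then have 0: "prob ?H = 0" using measure_nonneg[of M ?H] by linarith
    have "prob {\<omega> \<in> space M. \<forall>i\<le>Suc n. X i \<omega> = x i} \<le> prob ?H"
      by (rule finite_measure_mono) auto
    with 0 show ?thesis by (simp add: measure_le_0_iff)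
  qed
qed

lemma path_prob_pos:
  assumes X: "simple_random_walk M V E v X"
    and pos: "0 < prob {\<omega> \<in> space M. \<forall>i\<le>n. X i \<omega> = x i}"
  shows "x 0 = v \<and> (\<forall>i<n. x (Suc i) \<in> nb (x i)) \<and> x n \<in> V"
  using pos
proof (induction n)
  case 0
  then have "x 0 = v" using path_prob_0[OF X] by simp
  with X show ?case by (simp add: simple_random_walk_def)
next
  case (Suc n)
  from Suc.prems have "prob {\<omega> \<in> space M. \<forall>i\<le>n. X i \<omega> = x i} \<noteq> 0"
    and p: "pmf (pmf_of_set (nb (x n))) (x (Suc n)) \<noteq> 0"
    unfolding path_prob_Suc[OF X] by auto
  then have "0 < prob {\<omega> \<in> space M. \<forall>i\<le>n. X i \<omega> = x i}"
    by (simp add: zero_less_measure_iff)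
  then have IH: "x 0 = v \<and> (\<forall>i<n. x (Suc i) \<in> nb (x i)) \<and> x n \<in> V"
    using Suc.IH by blast
  then have "x (Suc n) \<in> nb (x n)"
    using p neighbours_nonempty[of "x n"] finite_neighbours[of "x n"]
    by (auto simp: indicator_def split: if_splits)
  moreover from this have "x (Suc n) \<in> V" by (simp add: neighbours_def)
  ultimately show ?case using IH by (auto simp: less_Suc_eq)
qed

lemma path_prob_neighbour:
  assumes X: "simple_random_walk M V E v X" and V: "x n \<in> V" and w: "w \<in> nb (x n)"
  shows "prob {\<omega> \<in> space M. \<forall>i\<le>Suc n. X i \<omega> = (x(Suc n := w)) i}
    = prob {\<omega> \<in> space M. \<forall>i\<le>n. X i \<omega> = x i} / real (card (nb (x n)))"
proof -
  have "{\<omega> \<in> space M. \<forall>i\<le>n. X i \<omega> = (x(Suc n := w)) i} = {\<omega> \<in> space M. \<forall>i\<le>n. X i \<omega> = x i}"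
    by auto
  then show ?thesis
    using path_prob_Suc[OF X, of n "x(Suc n := w)"] w neighbours_nonempty[OF V] finite_neighbours
    by (simp add: indicator_def)
qed

lemma AE_next_neighbour:
  assumes X: "simple_random_walk M V E v X" and V: "x n \<in> V"
  shows "AE \<omega> in M. (\<forall>i\<le>n. X i \<omega> = x i) \<longrightarrow> X (Suc n) \<omega> \<in> nb (x n)"
proof -
  note [measurable] = walk_measurable[OF X]
  let ?H = "{\<omega> \<in> space M. \<forall>i\<le>n. X i \<omega> = x i}"
  let ?G = "\<lambda>w. {\<omega> \<in> space M. \<forall>i\<le>Suc n. X i \<omega> = (x(Suc n := w)) i}"
  have G: "?G w = {\<omega> \<in> ?H. X (Suc n) \<omega> = w}" for w
    by (auto simp: le_Suc_eq)
  have "prob (\<Union>w\<in>nb (x n). ?G w) = (\<Sum>w\<in>nb (x n). prob (?G w))"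
    by (rule finite_measure_finite_Union) (auto simp: finite_neighbours disjoint_family_on_def)
  also have "\<dots> = (\<Sum>w\<in>nb (x n). prob ?H / real (card (nb (x n))))"
    by (intro sum.cong refl path_prob_neighbour X V)
  also have "\<dots> = prob ?H"
    using neighbours_nonempty[OF V] finite_neighbours by simp
  finally have "prob (?H - (\<Union>w\<in>nb (x n). ?G w)) = 0"
    by (subst finite_measure_Diff) (auto simp: G)
  then have "AE \<omega> in M. \<omega> \<notin> ?H - (\<Union>w\<in>nb (x n). ?G w)"
    by (subst (asm) prob_eq_0) (auto simp: G)
  then show ?thesis
    using AE_space by eventually_elim (auto simp: le_Suc_eq)
qed

end

locale independent_walks = walk_graph +
  fixes X X' :: "nat \<Rightarrow> 'a \<Rightarrow> 'b"
  assumes walk: "simple_random_walk M V E v X" and walk': "simple_random_walk M V E v X'"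
    and indep: "indep_var (\<Pi>\<^sub>M n\<in>UNIV. count_space UNIV) (\<lambda>\<omega> n. X n \<omega>)
      (\<Pi>\<^sub>M n\<in>UNIV. count_space UNIV) (\<lambda>\<omega> n. X' n \<omega>)"
begin

lemma X_measurable [measurable]:
  "X n \<in> measurable M (count_space UNIV)" "X' n \<in> measurable M (count_space UNIV)"
  by (rule walk_measurable[OF walk] walk_measurable[OF walk'])+

lemma eq_measurable [measurable]: "Measurable.pred M (\<lambda>\<omega>. X n \<omega> = X' n \<omega>)"
proof -
  have "Measurable.pred M (\<lambda>\<omega>. \<exists>u. X n \<omega> = u \<and> X' n \<omega> = u)" by measurable
  then show ?thesis by (rule measurable_cong[THEN iffD1, rotated]) auto
qed

definition history :: "nat \<Rightarrow> (nat \<Rightarrow> 'b) \<Rightarrow> (nat \<Rightarrow> 'b) \<Rightarrow> 'a \<Rightarrow> bool" where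
  "history n x y \<omega> \<longleftrightarrow> (\<forall>i\<le>n. X i \<omega> = x i) \<and> (\<forall>i\<le>n. X' i \<omega> = y i)"

lemma history_measurable [measurable]: "Measurable.pred M (history n x y)"
  unfolding history_def[abs_def] by measurable

lemma history_prob:
  "prob {\<omega> \<in> space M. history n x y \<omega>}
    = prob {\<omega> \<in> space M. \<forall>i\<le>n. X i \<omega> = x i} * prob {\<omega> \<in> space M. \<forall>i\<le>n. X' i \<omega> = y i}"
proof -
  let ?P = "\<Pi>\<^sub>M n\<in>UNIV. count_space UNIV :: 'b measure"
  let ?A = "\<lambda>x. {g \<in> space ?P. \<forall>i\<le>n. g i = x i}"
  have A: "?A z \<in> sets ?P" for z by measurable
  have "prob ((\<lambda>\<omega>. (\<lambda>n. X n \<omega>, \<lambda>n. X' n \<omega>)) -` (?A x \<times> ?A y) \<inter> space M)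
      = prob ((\<lambda>\<omega> n. X n \<omega>) -` ?A x \<inter> space M) * prob ((\<lambda>\<omega> n. X' n \<omega>) -` ?A y \<inter> space M)"
    by (rule indep_varD[OF indep A A])
  moreover have "(\<lambda>\<omega>. (\<lambda>n. X n \<omega>, \<lambda>n. X' n \<omega>)) -` (?A x \<times> ?A y) \<inter> space M
      = {\<omega> \<in> space M. history n x y \<omega>}"
    by (auto simp: history_def space_PiM)
  moreover have "(\<lambda>\<omega> n. X n \<omega>) -` ?A x \<inter> space M = {\<omega> \<in> space M. \<forall>i\<le>n. X i \<omega> = x i}"
    by (auto simp: space_PiM)
  moreover have "(\<lambda>\<omega> n. X' n \<omega>) -` ?A y \<inter> space M = {\<omega> \<in> space M. \<forall>i\<le>n. X' i \<omega> = y i}"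
    by (auto simp: space_PiM)
  ultimately show ?thesis by simp
qed

lemma history_pos:
  assumes "0 < prob {\<omega> \<in> space M. history n x y \<omega>}"
  shows "0 < prob {\<omega> \<in> space M. \<forall>i\<le>n. X i \<omega> = x i}" "0 < prob {\<omega> \<in> space M. \<forall>i\<le>n. X' i \<omega> = y i}"
  using assms measure_nonneg[of M "{\<omega> \<in> space M. \<forall>i\<le>n. X i \<omega> = x i}"]
  unfolding history_prob by (auto simp: zero_less_mult_iff)

text \<open>Condition on the next position of both walks, starting from a given joint history; there are finitely
  many possibilities, almost surely. An inequality suffices, so the pieces need not be shown disjoint.\<close>
lemma avoid_prob_le:
  "prob {\<omega> \<in> space M. history n x y \<omega> \<and> (\<forall>k\<le>T. X (n + k) \<omega> \<noteq> X' (n + k) \<omega>)}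
    \<le> prob {\<omega> \<in> space M. history n x y \<omega>} * avoid nb T (x n) (y n)"
proof (induction T arbitrary: n x y)
  case 0
  show ?case
  proof (cases "x n = y n")
    case True
    then have empty: "{\<omega> \<in> space M. history n x y \<omega> \<and> (\<forall>k\<le>0. X (n + k) \<omega> \<noteq> X' (n + k) \<omega>)} = {}"
      by (auto simp: history_def)
    show ?thesis unfolding empty using True by simp
  next
    case False
    then show ?thesis by (auto intro!: finite_measure_mono)
  qed
next
  case (Suc T)
  let ?H = "{\<omega> \<in> space M. history n x y \<omega>}"
  let ?A = "{\<omega> \<in> space M. history n x y \<omega> \<and> (\<forall>k\<le>Suc T. X (n + k) \<omega> \<noteq> X' (n + k) \<omega>)}"
  consider "prob ?H = 0" | "x n = y n" | "0 < prob ?H" "x n \<noteq> y n"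
    using measure_nonneg[of M ?H] by linarith
  then show ?case
  proof cases
    case 1
    have "prob ?A \<le> prob ?H" by (rule finite_measure_mono) auto
    then show ?thesis using 1 by simp
  next
    case 2
    then have "?A = {}" by (auto simp: history_def)
    then show ?thesis using 2 by (simp only: avoid_same) simp
  next
    case 3
    have xV: "x n \<in> V" using path_prob_pos[OF walk history_pos(1)[OF 3(1)]] by blast
    have yV: "y n \<in> V" using path_prob_pos[OF walk' history_pos(2)[OF 3(1)]] by blast
    let ?x = "\<lambda>w. x(Suc n := w)" and ?y = "\<lambda>z. y(Suc n := z)"
    let ?B = "\<lambda>wz. {\<omega> \<in> space M. history (Suc n) (?x (fst wz)) (?y (snd wz)) \<omega>
      \<and> (\<forall>k\<le>T. X (Suc n + k) \<omega> \<noteq> X' (Suc n + k) \<omega>)}"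
    let ?N = "nb (x n) \<times> nb (y n)"
    have "prob ?A \<le> prob (\<Union>wz\<in>?N. ?B wz)"
    proof (rule finite_measure_mono_AE)
      show "AE \<omega> in M. \<omega> \<in> ?A \<longrightarrow> \<omega> \<in> (\<Union>wz\<in>?N. ?B wz)"
        using AE_next_neighbour[where x = x, OF walk xV] AE_next_neighbour[where x = y, OF walk' yV]
      proof eventually_elim
        case (elim \<omega>)
        show ?case
        proof
          assume A: "\<omega> \<in> ?A"
          then have "(X (Suc n) \<omega>, X' (Suc n) \<omega>) \<in> ?N" using elim by (auto simp: history_def)
          moreover have "X (Suc n + k) \<omega> \<noteq> X' (Suc n + k) \<omega>" if "k \<le> T" for k
            using A that by (auto dest: spec[of _ "Suc k"])
          then have "\<omega> \<in> ?B (X (Suc n) \<omega>, X' (Suc n) \<omega>)"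
            using A by (auto simp: history_def le_Suc_eq)
          ultimately show "\<omega> \<in> (\<Union>wz\<in>?N. ?B wz)" by blast
        qed
      qed
    qed (use finite_neighbours in \<open>auto intro!: sets.finite_UN\<close>)
    also have "\<dots> \<le> (\<Sum>wz\<in>?N. prob (?B wz))"
      using finite_neighbours by (intro measure_UNION_le) auto
    also have "\<dots> = (\<Sum>w\<in>nb (x n). \<Sum>z\<in>nb (y n). prob (?B (w, z)))"
      by (simp add: sum.cartesian_product case_prod_beta)
    also have "\<dots> \<le> (\<Sum>w\<in>nb (x n). \<Sum>z\<in>nb (y n).
        prob ?H / (real (card (nb (x n))) * real (card (nb (y n)))) * avoid nb T w z)"
    proof (intro sum_mono)
      fix w z assume w: "w \<in> nb (x n)" and z: "z \<in> nb (y n)"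
      have "prob (?B (w, z)) \<le> prob {\<omega> \<in> space M. history (Suc n) (?x w) (?y z) \<omega>} * avoid nb T w z"
        using Suc.IH[of "Suc n" "?x w" "?y z"] by (simp only: fun_upd_same fst_conv snd_conv)
      also have "prob {\<omega> \<in> space M. history (Suc n) (?x w) (?y z) \<omega>}
          = prob ?H / (real (card (nb (x n))) * real (card (nb (y n))))"
        unfolding history_prob
        by (subst path_prob_neighbour[where x = x, OF walk xV w],
            subst path_prob_neighbour[where x = y, OF walk' yV z]) simp
      finally show "prob (?B (w, z)) \<le> \<dots> * avoid nb T w z" .
    qed
    also have "\<dots> = prob ?H * avoid nb (Suc T) (x n) (y n)"
      using 3(2) by (simp add: sum_distrib_left sum_divide_distrib)
    finally show ?thesis .
  qed
qed

text \<open>A path with finitely many collisions has a history, of some length \<open>n\<close>, from whose end on the walks never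
  meet. There are only countably many finite histories, and for each of them the event that it is
  followed by no meeting has probability zero.\<close>
lemma AE_infinite_collisions:
  assumes "\<And>n x y. 0 < prob {\<omega> \<in> space M. history n x y \<omega>} \<Longrightarrow> (\<lambda>T. avoid nb T (x n) (y n)) \<longlonglongrightarrow> 0"
  shows "AE \<omega> in M. infinite {n. X n \<omega> = X' n \<omega>}"
proof -
  have "AE \<omega> in M. \<not> (history n x y \<omega> \<and> (\<forall>k. X (n + k) \<omega> \<noteq> X' (n + k) \<omega>))" for n x y
  proof -
    let ?H = "{\<omega> \<in> space M. history n x y \<omega>}"
    let ?A = "{\<omega> \<in> space M. history n x y \<omega> \<and> (\<forall>k. X (n + k) \<omega> \<noteq> X' (n + k) \<omega>)}"
    have le: "prob ?A \<le> prob ?H * avoid nb T (x n) (y n)" for T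
    proof (rule order_trans[OF _ avoid_prob_le])
      show "prob ?A \<le> prob {\<omega> \<in> space M. history n x y \<omega> \<and> (\<forall>k\<le>T. X (n + k) \<omega> \<noteq> X' (n + k) \<omega>)}"
        by (rule finite_measure_mono) auto
    qed
    have "prob ?A \<le> 0"
    proof (cases "0 < prob ?H")
      case True
      have "(\<lambda>T. prob ?H * avoid nb T (x n) (y n)) \<longlonglongrightarrow> prob ?H * 0"
        by (intro tendsto_intros assms True)
      then have "prob ?A \<le> prob ?H * 0"
        by (rule LIMSEQ_le_const) (use le in blast)
      then show ?thesis by simp
    next
      case False
      then have "prob ?H = 0" using measure_nonneg[of M ?H] by linarith
      then show ?thesis using le[of 0] by simp
    qed
    then have "prob ?A = 0" using measure_nonneg[of M ?A] by linarith
    then show ?thesis by (subst (asm) prob_eq_0) auto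
  qed
  \<comment> \<open>Histories are encoded as lists because the type of infinite sequences is uncountable.\<close>
  then have "AE \<omega> in M. \<forall>n (l :: 'b list) (l' :: 'b list).
      \<not> (history n (nth l) (nth l') \<omega> \<and> (\<forall>k. X (n + k) \<omega> \<noteq> X' (n + k) \<omega>))"
    unfolding AE_all_countable by blast
  then show ?thesis
  proof eventually_elim
    case (elim \<omega>)
    have "\<exists>m\<ge>n. X m \<omega> = X' m \<omega>" for n
    proof -
      let ?l = "\<lambda>Y. map (\<lambda>i. Y i \<omega>) [0..<Suc n]"
      have "history n (nth (?l X)) (nth (?l X')) \<omega>"
        by (auto simp: history_def nth_append simp del: upt_Suc)
      with elim obtain k where "X (n + k) \<omega> = X' (n + k) \<omega>" by blast
      then show ?thesis by (intro exI[of _ "n + k"]) simp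
    qed
    then show ?case by (auto simp: infinite_nat_iff_unbounded_le)
  qed
qed

end

section \<open>Infinitely many collisions on the wedge comb\<close>

theorem corollary1p1:
  fixes f :: "int \<Rightarrow> real"
    and M :: "'w measure"
    and X X' :: "nat \<Rightarrow> 'w \<Rightarrow> int \<times> int"
    and v :: "int \<times> int"
  assumes "\<And>x. 0 \<le> f x"
    and "(\<lambda>n::nat. f (- int n) + f (int n)) \<in> O(\<lambda>n. real n * ln (real n))"
    and "prob_space M"
    and "simple_random_walk M (comb_verts f) (comb_edges f) v X"
    and "simple_random_walk M (comb_verts f) (comb_edges f) v X'"
    and "prob_space.indep_var M
           (\<Pi>\<^sub>M n\<in>UNIV. count_space UNIV) (\<lambda>\<omega> n. X n \<omega>)
           (\<Pi>\<^sub>M n\<in>UNIV. count_space UNIV) (\<lambda>\<omega> n. X' n \<omega>)"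
  shows "AE \<omega> in M. infinite {n. X n \<omega> = X' n \<omega>}"
proof -
  interpret prob_space M by fact
  interpret independent_walks M "comb_verts f" "comb_edges f" v X X'
    using assms by unfold_locales (auto simp: finite_neighbours_comb neighbours_comb_nonempty)
  obtain s where s: "\<And>x y. (\<lambda>T. avoid (comb_nb f) T x y) \<longlonglongrightarrow> s x y"
    and s01: "\<And>x y. 0 \<le> s x y" "\<And>x y. s x y \<le> 1" and s_diag: "\<And>x. s x x = 0"
    and s_step: "\<And>x y. x \<noteq> y \<Longrightarrow> s x y = (\<Sum>w\<in>comb_nb f x. \<Sum>z\<in>comb_nb f y. s w z)
        / (real (card (comb_nb f x)) * real (card (comb_nb f y)))"
    by (rule avoid_tendsto[of "comb_nb f"]) (rule that, assumption+)
  show ?thesis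
  proof (rule AE_infinite_collisions)
    fix n x y assume pos: "0 < prob {\<omega> \<in> space M. history n x y \<omega>}"
    have x: "x 0 = v \<and> (\<forall>i<n. x (Suc i) \<in> comb_nb f (x i)) \<and> x n \<in> comb_verts f"
      by (rule path_prob_pos[OF walk history_pos(1)[OF pos]])
    have y: "y 0 = v \<and> (\<forall>i<n. y (Suc i) \<in> comb_nb f (y i)) \<and> y n \<in> comb_verts f"
      by (rule path_prob_pos[OF walk' history_pos(2)[OF pos]])
    have "k \<le> n \<Longrightarrow> par (x k) = par (y k)" for k
    proof (induction k)
      case (Suc k)
      then show ?case
        using x y par_comb_nb[of "x (Suc k)" f "x k"] par_comb_nb[of "y (Suc k)" f "y k"] by auto
    qed (use x y in simp)
    then have "par (x n) = par (y n)" by simp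
    then have "s (x n) (y n) = 0"
      using x y s_step by (intro avoidance_zero[OF assms(1,2) s01 s_diag]) auto
    then show "(\<lambda>T. avoid (comb_nb f) T (x n) (y n)) \<longlonglongrightarrow> 0"
      using s[of "x n" "y n"] by simp
  qed
qed

end
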